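(* Let $V$ be a $d$-dimensional Euclidean space with scalar product $\langle\cdot,\cdot\rangle$, $\Lambda\subset V$ a lattice and $\Lambda^* = \{x\in V:\langle x,y\rangle\in\mathbb{Z}\ \forall y\in\Lambda\}$ its dual lattice. For $l\in\Lambda^*$ and a polytope $P$ let $\Phi_l(P) = \int_P\exp\{2\pi i\langle l,x\rangle\}\,dx$. Let $P\subset V$ be a full-dimensional $\Lambda$-rational polytope and $t$ a positive integer such that $tP$ has all vertices in $\Lambda$. Let $\epsilon\geq 0$ be rational, $a\in V$, and $l\in\Lambda^*$. Then there exist functions $f_i(P,\epsilon,a,l;\cdot):\mathbb{N}\to\mathbb{C}$, $i=0,\dots,d$, such that $\Phi_l\bigl((n+\epsilon)P+a\bigr) = \sum_{i=0}^d f_i(P,\epsilon,a,l;n)n^i$ for all $n\in\mathbb{N}$ and $f_i(P,\epsilon,a,l;n+t) = f_i(P,\epsilon,a,l;n)$ for all $n\in\mathbb{N}$ and $i=0,\dots,d$. Moreover, if $0\le k\le d$ and $f_{d-k}(P,\epsilon,a,l;n)\neq 0$ for some $n$, then there exists a $(d-k)$-dimensional face $F$ of $P$ such that $l$ is orthogonal to $\operatorname{lin}(F)$.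
   Context: A polytope $P\subset V$ is $\Lambda$-rational if $sP$ has vertices in $\Lambda$ for some positive integer $s$. $dx$ is Lebesgue measure on $V$. For a face $F$, $\operatorname{lin}(F)$ denotes the linear subspace parallel to the affine hull of $F$. $(n+\epsilon)P+a = \{(n+\epsilon)x + a: x\in P\}$. *)

theory Defs
  imports "HOL-Analysis.Analysis"
begin

text \<open>Lattices have full rank: they are the integer spans of the bases of the ambient space.\<close>

definition euclidean_lattice :: "'a::euclidean_space set \<Rightarrow> bool" where
  "euclidean_lattice L \<longleftrightarrow>
     (\<exists>B. independent B \<and> span B = UNIV \<and>
          L = range (\<lambda>c :: 'a \<Rightarrow> int. \<Sum>b\<in>B. of_int (c b) *\<^sub>R b))"

definition dual_lattice :: "'a::euclidean_space set \<Rightarrow> 'a set" where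
  "dual_lattice L = {x. \<forall>y\<in>L. x \<bullet> y \<in> \<int>}"

definition lattice_polytope :: "'a::euclidean_space set \<Rightarrow> 'a set \<Rightarrow> bool" where
  "lattice_polytope L P \<longleftrightarrow> polytope P \<and> {v. v extreme_point_of P} \<subseteq> L"

definition rational_polytope :: "'a::euclidean_space set \<Rightarrow> 'a set \<Rightarrow> bool" where
  "rational_polytope L P \<longleftrightarrow>
     polytope P \<and> (\<exists>s::nat. s > 0 \<and> lattice_polytope L ((\<lambda>x. real s *\<^sub>R x) ` P))"

definition lin :: "'a::euclidean_space set \<Rightarrow> 'a set" where
  "lin F = {x - y | x y. x \<in> affine hull F \<and> y \<in> affine hull F}"

definition Phi :: "'a::euclidean_space \<Rightarrow> 'a set \<Rightarrow> complex" where
  "Phi l P = (LINT x:P|lebesgue. exp (2 * complex_of_real pi * \<i> * complex_of_real (l \<bullet> x)))"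

end

theory Submission
  imports Defs
begin

text \<open>
  If \<open>l\<close> is orthogonal to \<open>lin F\<close>, then the integral of the wave \<open>exp (2 \<pi> i \<langle>l, x\<rangle>)\<close>
  over \<open>s F\<close>, thickened by a fixed transversal set \<open>Z\<close>, is a constant times
  \<open>s ^ dim F\<close> times the wave at \<open>s v\<close>, for any vertex \<open>v\<close> of \<open>F\<close>. Otherwise there is
  \<open>w \<in> lin F\<close> with \<open>\<langle>l, w\<rangle> = 1/2\<close>; comparing \<open>s F + Z\<close> with its translate by \<open>w\<close> expresses
  the integral through the facets \<open>C\<close> of \<open>F\<close>, scaled by \<open>s\<close> and thickened by the sum of
  \<open>Z\<close> and the segment from 0 to \<open>\<plusminus>w\<close>. By induction on the dimension, the integral over \<open>s P\<close> is
  a sum of terms \<open>c\<^sub>F s ^ dim F wave (s v\<^sub>F)\<close> over the faces \<open>F\<close> orthogonal to \<open>l\<close>.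
  Expanding \<open>s = n + \<epsilon>\<close> binomially gives the coefficients; they are periodic because
  \<open>\<langle>l, t v\<^sub>F\<rangle>\<close> is an integer, and a face orthogonal to \<open>l\<close> has subfaces of all smaller
  dimensions.
\<close>

subsection \<open>Linear changes of variables\<close>

text \<open>Uniqueness of Haar measure: the integral of
  \<open>indicator B y * indicator A (x + y)\<close> over \<open>lborel\<close> and
  \<open>M\<close>, with \<open>B\<close> the unit ball, is evaluated in two ways. The result is a
  product identity because the values are extended reals and the ball might have infinite measure
  under \<open>M\<close>.\<close>

lemma translation_invariant_measure_proportional:
  fixes M :: "'a::euclidean_space measure"
  assumes sf: "sigma_finite_measure M" and sM [measurable_cong]: "sets M = sets borel"
    and inv: "\<And>c. distr M borel ((+) c) = M"
    and A [measurable]: "A \<in> sets borel"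
  shows "emeasure lborel (cball 0 1 :: 'a set) * emeasure M A
       = emeasure M (cball 0 1) * emeasure lborel A"
proof -
  interpret M: sigma_finite_measure M by (rule sf)
  interpret pair_sigma_finite lborel M
    by (simp add: pair_sigma_finite_def lborel.sigma_finite_measure_axioms sf)
  define B where "B = (cball 0 1 :: 'a set)"
  have B [measurable]: "B \<in> sets borel" by (simp add: B_def)
  have M_shift: "(\<integral>\<^sup>+x. g (c + x) \<partial>M) = (\<integral>\<^sup>+x. g x \<partial>M)"
    if [measurable]: "g \<in> borel_measurable borel" for g :: "'a \<Rightarrow> ennreal" and c
    by (subst inv[of c, symmetric], subst nn_integral_distr) auto
  have L_shift: "(\<integral>\<^sup>+x. g (c + x) \<partial>lborel) = (\<integral>\<^sup>+x. g x \<partial>lborel)"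
    if [measurable]: "g \<in> borel_measurable borel" for g :: "'a \<Rightarrow> ennreal" and c
    by (subst (2) lborel_distr_plus[of c, symmetric], subst nn_integral_distr) auto
  have "emeasure lborel B * emeasure M A
      = (\<integral>\<^sup>+y. indicator B y * (\<integral>\<^sup>+x. indicator A (y + x) \<partial>M) \<partial>lborel)"
    by (subst M_shift) (auto simp: sM nn_integral_multc)
  also have "\<dots> = (\<integral>\<^sup>+y. \<integral>\<^sup>+x. indicator B y * indicator A (x + y) \<partial>M \<partial>lborel)"
    by (subst nn_integral_cmult[symmetric]) (auto simp: add.commute)
  also have "\<dots> = (\<integral>\<^sup>+x. \<integral>\<^sup>+y. indicator B y * indicator A (x + y) \<partial>lborel \<partial>M)"
    by (rule Fubini'[symmetric]) measurable
  \<comment> \<open>Invariance of \<open>lborel\<close> allows the substitution of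
    \<open>y - x\<close> for \<open>y\<close>, which moves \<open>x\<close> from the argument of
    \<open>A\<close> to that of \<open>B\<close>.\<close>
  also have "\<dots> = (\<integral>\<^sup>+x. \<integral>\<^sup>+y. indicator B (- x + (x + y)) * indicator A (x + y) \<partial>lborel \<partial>M)"
    by simp
  also have "\<dots> = (\<integral>\<^sup>+x. \<integral>\<^sup>+y. indicator B (- x + y) * indicator A y \<partial>lborel \<partial>M)"
  proof (rule nn_integral_cong)
    fix x :: 'a
    show "(\<integral>\<^sup>+y. indicator B (- x + (x + y)) * indicator A (x + y) \<partial>lborel)
        = (\<integral>\<^sup>+y. indicator B (- x + y) * indicator A y \<partial>lborel)"
      by (rule L_shift) measurable
  qed
  also have "\<dots> = (\<integral>\<^sup>+y. \<integral>\<^sup>+x. indicator B (- x + y) * indicator A y \<partial>M \<partial>lborel)"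
    by (rule Fubini') measurable
  \<comment> \<open>The ball is symmetric about 0, so the sign of its argument may be changed; then
    invariance of \<open>M\<close> removes \<open>y\<close> from it.\<close>
  also have "\<dots> = (\<integral>\<^sup>+y. \<integral>\<^sup>+x. indicator B (- y + x) * indicator A y \<partial>M \<partial>lborel)"
    by (intro nn_integral_cong) (auto simp: B_def indicator_def norm_minus_commute)
  also have "\<dots> = (\<integral>\<^sup>+y. (\<integral>\<^sup>+x. indicator B (- y + x) \<partial>M) * indicator A y \<partial>lborel)"
    by (subst nn_integral_multc) auto
  also have "\<dots> = emeasure M B * emeasure lborel A"
    by (subst M_shift) (auto simp: sM nn_integral_cmult)
  finally show ?thesis by (simp add: B_def)
qed

text \<open>Bridge between the gauge integral, convenient for unions with null overlaps, and the
  integral against \<open>lborel\<close>, for which the rules \<open>integral_distr\<close> and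
  \<open>integral_density\<close> hold.\<close>

lemma integral_compact_lborel:
  fixes f :: "'a::euclidean_space \<Rightarrow> 'b::euclidean_space"
  assumes "compact K" "continuous_on K f"
  shows "f integrable_on K" "integral K f = (\<integral>x. indicator K x *\<^sub>R f x \<partial>lborel)"
proof -
  have *: "integrable lborel (\<lambda>x. indicator K x *\<^sub>R f x)"
    by (rule borel_integrable_compact[OF assms])
  have "((\<lambda>x. indicator K x *\<^sub>R f x) has_integral (\<integral>x. indicator K x *\<^sub>R f x \<partial>lborel)) UNIV"
    by (rule has_integral_integral_lborel[OF *])
  moreover have "(\<lambda>x. indicator K x *\<^sub>R f x) = (\<lambda>x. if x \<in> K then f x else 0)"
    by (auto simp: indicator_def)
  ultimately have "(f has_integral (\<integral>x. indicator K x *\<^sub>R f x \<partial>lborel)) K"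
    by (simp add: has_integral_restrict_UNIV)
  then show "f integrable_on K" "integral K f = (\<integral>x. indicator K x *\<^sub>R f x \<partial>lborel)"
    by (auto simp: integrable_on_def integral_unique)
qed

lemma integral_compact_translation:
  fixes f :: "'a::euclidean_space \<Rightarrow> 'b::euclidean_space"
  assumes "compact K" and f: "continuous_on UNIV f"
  shows "integral ((+) w ` K) f = integral K (\<lambda>x. f (w + x))"
proof -
  have [measurable]: "f \<in> borel_measurable borel" 
    by (rule borel_measurable_continuous_onI[OF f])
  have K': "compact ((+) w ` K)" using assms compact_translation by blast
  have [measurable]: "K \<in> sets borel" "(+) w ` K \<in> sets borel"
    using assms K' by (auto intro: borel_compact)
  have "integral ((+) w ` K) f = (\<integral>x. indicator ((+) w ` K) x *\<^sub>R f x \<partial>distr lborel borel ((+) w))"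
    by (subst integral_compact_lborel[OF K' continuous_on_subset[OF f]]) (auto simp: lborel_distr_plus)
  also have "\<dots> = (\<integral>x. indicator ((+) w ` K) (w + x) *\<^sub>R f (w + x) \<partial>lborel)"
    by (rule integral_distr) auto
  also have "\<dots> = (\<integral>x. indicator K x *\<^sub>R f (w + x) \<partial>lborel)"
    by (intro Bochner_Integration.integral_cong) (auto simp: indicator_def)
  also have "\<dots> = integral K (\<lambda>x. f (w + x))"
    by (rule integral_compact_lborel(2)[symmetric])
      (auto intro!: assms continuous_intros continuous_on_compose2[OF f])
  finally show ?thesis .
qed

text \<open>The image \<open>M\<close> of \<open>lborel\<close> under the inverse of
  \<open>g\<close> is translation invariant and finite on compact sets, hence a multiple of
  \<open>lborel\<close>. The factor is the absolute value of the determinant, but what is recorded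
  is only that it is the same for all \<open>K\<close> and \<open>f\<close>.\<close>

lemma integral_compact_linear_image:
  fixes g :: "'a::euclidean_space \<Rightarrow> 'a"
  assumes g: "linear g" and "bij g"
  obtains c where "\<And>K (f :: 'a \<Rightarrow> 'b::euclidean_space). \<lbrakk>compact K; continuous_on UNIV f\<rbrakk> \<Longrightarrow>
    integral (g ` K) f = c *\<^sub>R integral K (\<lambda>x. f (g x))"
proof -
  define h where "h = inv g"
  have hg: "h (g x) = x" and gh: "g (h x) = x" for x
    using \<open>bij g\<close> by (auto simp: h_def bij_is_inj bij_is_surj surj_f_inv_f)
  have h: "linear h"
    using linear_injective_left_inverse[OF g] hg gh
    by (metis (no_types, lifting) g linear_iff)
  have gc: "continuous_on UNIV g" and hc: "continuous_on UNIV h"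
    using g h by (simp_all add: linear_continuous_on linear_linear)
  have [measurable]: "g \<in> borel_measurable borel" "h \<in> borel_measurable borel"
    by (simp_all add: borel_measurable_continuous_onI gc hc)
  define M where "M = distr lborel borel h"
  have sM: "sets M = sets borel" by (simp add: M_def)
  have h_vimage: "h -` A = g ` A" for A
    using hg gh by (auto simp: image_iff) metis
  have eM: "emeasure M A = emeasure lborel (g ` A)" if "A \<in> sets borel" for A
    unfolding M_def using that by (subst emeasure_distr) (auto simp: h_vimage)
  have cpt: "compact (g ` K)" if "compact K" for K
    using that gc by (meson compact_continuous_image continuous_on_subset top_greatest)
  have fin: "emeasure M K < \<infinity>" if "compact K" for K
    using eM[of K] that cpt emeasure_compact_finite[OF cpt] by (auto simp: borel_compact)
  have "sigma_finite_measure M"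
  proof
    show "\<exists>A. countable A \<and> A \<subseteq> sets M \<and> \<Union> A = space M \<and> (\<forall>a\<in>A. emeasure M a \<noteq> \<infinity>)"
    proof (intro exI[of _ "range (\<lambda>n::nat. cball 0 (real n))"] conjI ballI)
      show "\<Union> (range (\<lambda>n::nat. cball (0::'a) (real n))) = space M"
        using real_arch_simple by (fastforce simp: M_def)
    qed (use fin in \<open>auto simp: sM less_top\<close>)
  qed
  moreover have "distr M borel ((+) c) = M" for c
  proof -
    have "distr M borel ((+) c) = distr lborel borel (\<lambda>x. c + h x)"
      unfolding M_def by (subst distr_distr) (auto simp: o_def)
    \<comment> \<open>Translating by \<open>c\<close> after \<open>h\<close> is translating by
      \<open>g c\<close> before \<open>h\<close>, so invariance passes from \<open>lborel\<close> to
      \<open>M\<close>.\<close>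
    also have "(\<lambda>x. c + h x) = (\<lambda>x. h (g c + x))"
      using h by (simp add: linear_add hg)
    also have "distr lborel borel (\<lambda>x. h (g c + x)) = distr (distr lborel borel ((+) (g c))) borel h"
      by (subst distr_distr) (auto simp: o_def)
    finally show ?thesis by (simp add: lborel_distr_plus M_def)
  qed
  ultimately have proportional: "emeasure lborel (cball 0 1 :: 'a set) * emeasure M A
      = emeasure M (cball 0 1) * emeasure lborel A" if "A \<in> sets borel" for A
    using translation_invariant_measure_proportional[of M A] that sM by auto
  define \<beta> where "\<beta> = measure lborel (cball (0::'a) 1)"
  define \<mu> where "\<mu> = measure M (cball (0::'a) 1)"
  have \<beta>: "emeasure lborel (cball (0::'a) 1) = ennreal \<beta>" "\<beta> > 0"
    unfolding \<beta>_def using emeasure_compact_finite[of "cball (0::'a) 1"]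
    by (auto intro!: emeasure_eq_ennreal_measure content_cball_pos simp: less_top)
  have \<mu>: "emeasure M (cball (0::'a) 1) = ennreal \<mu>" "\<mu> \<ge> 0"
    unfolding \<mu>_def using fin[of "cball 0 1"]
    by (auto intro!: emeasure_eq_ennreal_measure simp: less_top)
  define c where "c = \<mu> / \<beta>"
  have c: "c \<ge> 0" using \<beta> \<mu> by (simp add: c_def)
  have M_eq: "M = density lborel (\<lambda>_. ennreal c)"
  proof (rule measure_eqI)
    show "sets M = sets (density lborel (\<lambda>_. ennreal c))" by (simp add: sM)
    fix A assume "A \<in> sets M"
    then have A: "A \<in> sets borel" by (simp add: sM)
    have "ennreal (1 / \<beta>) * (ennreal \<beta> * emeasure M A) = ennreal (1 / \<beta>) * (ennreal \<mu> * emeasure lborel A)"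
      using proportional[OF A] \<beta> \<mu> by simp
    then have "emeasure M A = ennreal c * emeasure lborel A"
      using \<beta> \<mu> by (simp add: mult.assoc[symmetric] ennreal_mult'[symmetric] c_def)
    then show "emeasure M A = emeasure (density lborel (\<lambda>_. ennreal c)) A"
      using A by (simp add: emeasure_density_const)
  qed
  have "integral (g ` K) f = c *\<^sub>R integral K (\<lambda>x. f (g x))"
    if K: "compact K" and f: "continuous_on UNIV f" for K and f :: "'a \<Rightarrow> 'b"
  proof -
    have [measurable]: "f \<in> borel_measurable borel" 
      by (rule borel_measurable_continuous_onI[OF f])
    have [measurable]: "K \<in> sets borel" using K by (auto intro: borel_compact)
    have "integral (g ` K) f = (\<integral>x. indicator (g ` K) x *\<^sub>R f x \<partial>lborel)"
      by (rule integral_compact_lborel(2)[OF cpt[OF K] continuous_on_subset[OF f]]) auto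
    also have "\<dots> = (\<integral>x. indicator K (h x) *\<^sub>R f (g (h x)) \<partial>lborel)"
      using h_vimage[of K]
      by (intro Bochner_Integration.integral_cong) (auto simp: indicator_def gh)
    also have "\<dots> = (\<integral>x. indicator K x *\<^sub>R f (g x) \<partial>M)"
      unfolding M_def by (rule integral_distr[symmetric]) auto
    also have "\<dots> = c *\<^sub>R (\<integral>x. indicator K x *\<^sub>R f (g x) \<partial>lborel)"
      unfolding M_eq using c by (subst integral_density) (auto simp flip: scaleR_scaleR)
    also have "\<dots> = c *\<^sub>R integral K (\<lambda>x. f (g x))"
      by (subst integral_compact_lborel(2)[OF K])
        (auto intro!: continuous_on_compose2[OF f] continuous_on_subset[OF gc])
    finally show ?thesis .
  qed
  then show thesis by (rule that)
qed

subsection \<open>Linear hulls and front facets\<close>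

lemma lin_mono: "F \<subseteq> G \<Longrightarrow> lin F \<subseteq> lin G"
  unfolding lin_def using hull_mono[of F G affine] by blast

lemma mem_lin_iff: "u \<in> lin F \<longleftrightarrow> (\<exists>x\<in>affine hull F. \<exists>y\<in>affine hull F. u = x - y)"
  unfolding lin_def mem_Collect_eq by metis

lemma diff_in_lin: "x \<in> F \<Longrightarrow> y \<in> F \<Longrightarrow> x - y \<in> lin F"
  by (meson mem_lin_iff hull_inc)

text \<open>A base point turns \<open>lin F\<close> into a translated affine hull, the form in which
  the library treats subspaces of directions and their dimension.\<close>

lemma lin_eq_translate:
  assumes a: "a \<in> affine hull F"
  shows "lin F = (+) (- a) ` (affine hull F)"
proof (intro subset_antisym subsetI)
  fix u assume "u \<in> lin F"
  then obtain x y where u: "u = x - y" and xy: "x \<in> affine hull F" "y \<in> affine hull F"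
    by (auto simp: mem_lin_iff)
  have "a + 1 *\<^sub>R (x - y) \<in> affine hull F"
    by (rule mem_affine_3_minus[OF affine_affine_hull a xy])
  then show "u \<in> (+) (- a) ` (affine hull F)"
    unfolding u by (intro image_eqI[of _ _ "a + (x - y)"]) simp_all
next
  fix u assume "u \<in> (+) (- a) ` (affine hull F)"
  then obtain x where "x \<in> affine hull F" "u = - a + x" by blast
  then show "u \<in> lin F" unfolding mem_lin_iff using a by (intro bexI[of _ x] bexI[of _ a]) simp_all
qed

lemma subspace_lin:
  assumes "F \<noteq> {}" shows "subspace (lin F)"
proof -
  obtain a where "a \<in> affine hull F" using assms by (meson ex_in_conv hull_inc)
  then show ?thesis
    using affine_diffs_subspace[of "affine hull F" a] by (simp add: lin_eq_translate)
qed

lemma dim_lin: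
  assumes "F \<noteq> {}" shows "int (dim (lin F)) = aff_dim F"
proof -
  obtain a where "a \<in> affine hull F" using assms by (meson ex_in_conv hull_inc)
  then show ?thesis
    using aff_dim_eq_dim[of a "affine hull F"] by (simp add: lin_eq_translate)
qed

lemma affine_hull_add_lin:
  assumes "x \<in> affine hull F" "u \<in> lin F" shows "x + c *\<^sub>R u \<in> affine hull F"
  using assms mem_affine_3_minus[OF affine_affine_hull, of x F] by (auto simp: mem_lin_iff)

lemma lin_inner_eq_0:
  assumes "F \<subseteq> {x. a \<bullet> x = b}" "u \<in> lin F" shows "a \<bullet> u = 0"
proof -
  have "affine hull F \<subseteq> {x. a \<bullet> x = b}"
    using assms(1) by (simp add: hull_minimal affine_hyperplane)
  then show ?thesis using assms(2) by (auto simp: mem_lin_iff inner_diff_right subset_iff)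
qed

lemma lin_scale:
  assumes "s \<noteq> 0" shows "lin ((\<lambda>x. s *\<^sub>R x) ` F) = lin F"
proof (cases "F = {}")
  case True then show ?thesis by simp
next
  case False
  have eq: "affine hull ((\<lambda>x. s *\<^sub>R x) ` F) = (\<lambda>x. s *\<^sub>R x) ` (affine hull F)"
    by (rule affine_hull_linear_image[OF bounded_linear_scaleR_right, symmetric])
  have sub: "subspace (lin F)" by (rule subspace_lin[OF False])
  show ?thesis
  proof safe
    fix u assume "u \<in> lin ((\<lambda>x. s *\<^sub>R x) ` F)"
    then obtain x y where "u = s *\<^sub>R (x - y)" "x \<in> affine hull F" "y \<in> affine hull F"
      by (auto simp: mem_lin_iff eq scaleR_diff_right)
    then show "u \<in> lin F"
      using subspace_scale[OF sub, of "x - y" s] by (auto simp: mem_lin_iff)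
  next
    fix u assume "u \<in> lin F"
    then have "(1 / s) *\<^sub>R u \<in> lin F" using subspace_scale[OF sub] by blast
    then obtain x y where "(1 / s) *\<^sub>R u = x - y" and xy: "x \<in> affine hull F" "y \<in> affine hull F"
      by (auto simp: mem_lin_iff)
    from this(1) have "s *\<^sub>R ((1 / s) *\<^sub>R u) = s *\<^sub>R (x - y)" by simp
    then have "u = s *\<^sub>R x - s *\<^sub>R y" using assms by (simp add: scaleR_diff_right)
    then show "u \<in> lin ((\<lambda>x. s *\<^sub>R x) ` F)" using xy by (auto simp: mem_lin_iff eq)
  qed
qed

text \<open>\<open>A + T\<close> lies in a translate of the sum of \<open>T\<close> and the
  direction space of \<open>A\<close>, and the dimension of that sum is too small for positive
  volume.\<close>

lemma negligible_plus_subspace: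
  fixes A T :: "'a::euclidean_space set"
  assumes T: "subspace T" and dim: "aff_dim A + int (dim T) < int DIM('a)"
  shows "negligible (A + T)"
proof (cases "A = {}")
  case True then show ?thesis by (simp add: set_plus_def)
next
  case False
  then obtain a where a: "a \<in> A" by auto
  define A' where "A' = span ((+) (- a) ` A)"
  define U where "U = {x + y |x y. x \<in> A' \<and> y \<in> T}"
  have "dim U + dim (A' \<inter> T) = dim A' + dim T"
    unfolding U_def by (rule dim_sums_Int) (auto simp: A'_def T)
  moreover have "int (dim A') = aff_dim A"
    using aff_dim_eq_dim[of a A] a by (simp add: A'_def hull_inc)
  ultimately have "dim U < DIM('a)" using dim by linarith
  then have "negligible ((+) a ` U)" by (simp add: negligible_lowdim negligible_translation)
  moreover have "A + T \<subseteq> (+) a ` U"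
  proof
    fix z assume "z \<in> A + T"
    then obtain x y where xy: "z = x + y" "x \<in> A" "y \<in> T" by (auto elim: set_plus_elim)
    have "- a + x \<in> A'" using xy by (auto simp: A'_def intro: span_base)
    then have "(- a + x) + y \<in> U" using xy by (auto simp: U_def)
    moreover have "z = a + ((- a + x) + y)" using xy by simp
    ultimately show "z \<in> (+) a ` U" by blast
  qed
  ultimately show ?thesis using negligible_subset by blast
qed

text \<open>The facets through which \<open>Q\<close> is left when moving in direction \<open>w\<close>.\<close>

definition front :: "'a::euclidean_space set \<Rightarrow> 'a \<Rightarrow> 'a set set" where
  "front Q w = {C. C facet_of Q \<and>
     (\<exists>a b. a \<bullet> w > 0 \<and> C = Q \<inter> {x. a \<bullet> x = b} \<and> Q \<subseteq> {x. a \<bullet> x \<le> b})}"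

lemma in_closed_segment_0: "x \<in> closed_segment 0 w \<longleftrightarrow> (\<exists>u\<ge>0. u \<le> 1 \<and> x = u *\<^sub>R w)"
  by (auto simp: in_segment)

text \<open>Where the ray from a point of \<open>Q\<close> in direction \<open>w\<close> leaves
  \<open>Q\<close>, it crosses a front facet; the rest of the way is a shorter multiple of
  \<open>w\<close> and so belongs to the prism over that facet.\<close>

lemma polytope_sweep_front:
  assumes Q: "polytope Q" and w: "w \<in> lin Q"
  shows "Q + closed_segment 0 w \<subseteq> Q \<union> (\<Union>C\<in>front Q w. C + closed_segment 0 w)"
proof
  fix x assume "x \<in> Q + closed_segment 0 w"
  then obtain q u where q: "q \<in> Q" and u: "0 \<le> u" "u \<le> 1" and x: "x = q + u *\<^sub>R w"
    by (auto simp: in_closed_segment_0 elim!: set_plus_elim)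
  \<comment> \<open>Minimality of the half-space representation makes every bounding hyperplane cut
    out a facet.\<close>
  obtain H where H: "finite H" and QH: "Q = affine hull Q \<inter> \<Inter>H"
    and half: "\<forall>h\<in>H. \<exists>a b. a \<noteq> 0 \<and> h = {x. a \<bullet> x \<le> b} \<and> (\<forall>x\<in>affine hull Q. x + a \<in> affine hull Q)"
    and min: "\<forall>H'. H' \<subset> H \<longrightarrow> Q \<subset> affine hull Q \<inter> \<Inter>H'"
    using polytope_imp_polyhedron[OF Q] unfolding polyhedron_Int_affine_parallel_minimal by blast
  from half obtain a b where ab: "\<And>h. h \<in> H \<Longrightarrow> a h \<noteq> 0 \<and> h = {x. a h \<bullet> x \<le> b h}"
  proof -
    from half have "\<forall>h\<in>H. \<exists>a. \<exists>b. a \<noteq> 0 \<and> h = {x. a \<bullet> x \<le> b}" by meson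
    from bchoice[OF this] obtain a where "\<forall>h\<in>H. \<exists>b. a h \<noteq> 0 \<and> h = {x. a h \<bullet> x \<le> b}" ..
    from bchoice[OF this] that show thesis by meson
  qed
  have facet: "C facet_of Q \<longleftrightarrow> (\<exists>h. h \<in> H \<and> C = Q \<inter> {x. a h \<bullet> x = b h})" for C
    by (rule facet_of_polyhedron_explicit[OF H QH ab]) (assumption | rule min[rule_format])+
  have inQ: "y \<in> Q \<longleftrightarrow> y \<in> affine hull Q \<and> (\<forall>h\<in>H. a h \<bullet> y \<le> b h)" for y
  proof -
    have "y \<in> h \<longleftrightarrow> a h \<bullet> y \<le> b h" if "h \<in> H" for h
      using arg_cong[where f="\<lambda>S. y \<in> S", OF conjunct2[OF ab[OF that]]]
      by (simp only: mem_Collect_eq)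
    moreover have "y \<in> Q \<longleftrightarrow> y \<in> affine hull Q \<and> (\<forall>h\<in>H. y \<in> h)"
      by (subst (1) QH) simp
    ultimately show ?thesis by simp
  qed
  \<comment> \<open>As \<open>w\<close> lies in \<open>lin Q\<close>, the ray stays in the affine
    hull, so \<open>Q\<close> can be left only by violating an inequality from
    \<open>H\<close>.\<close>
  have aff: "q + c *\<^sub>R w \<in> affine hull Q" for c
    by (intro affine_hull_add_lin w hull_inc q)
  show "x \<in> Q \<union> (\<Union>C\<in>front Q w. C + closed_segment 0 w)"
  proof (cases "x \<in> Q")
    case False
    \<comment> \<open>\<open>H'\<close> holds the inequalities that tighten along \<open>w\<close>,
      and \<open>\<sigma> h\<close> is the time at which the ray meets the hyperplane of
      \<open>h\<close>. The least such time is the exit time.\<close>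
    define H' where "H' = {h\<in>H. a h \<bullet> w > 0}"
    define \<sigma> where "\<sigma> h = (b h - a h \<bullet> q) / (a h \<bullet> w)" for h
    obtain h0 where h0: "h0 \<in> H" "a h0 \<bullet> x > b h0"
      using False aff[of u] x by (auto simp: inQ not_le)
    have "a h0 \<bullet> q \<le> b h0" using q h0 by (simp add: inQ)
    then have pos: "0 < u * (a h0 \<bullet> w)" using h0 x by (simp add: inner_add_right)
    then have w0: "a h0 \<bullet> w > 0" using u(1) by (simp add: zero_less_mult_iff)
    have su: "\<sigma> h0 < u" using h0 x w0 by (simp add: \<sigma>_def field_simps inner_add_right)
    have h0': "h0 \<in> H'" using h0 w0 by (simp add: H'_def)
    have "finite H'" using H by (simp add: H'_def)
    then obtain h where h: "h \<in> H'" and hmin: "\<And>k. k \<in> H' \<Longrightarrow> \<sigma> h \<le> \<sigma> k"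
      using arg_min_if_finite[of H' \<sigma>] h0' by (metis empty_iff not_less)
    have hH: "h \<in> H" and hw: "a h \<bullet> w > 0" using h by (auto simp: H'_def)
    define p where "p = q + \<sigma> h *\<^sub>R w"
    have \<sigma>0: "\<sigma> h \<ge> 0" using q hH hw by (simp add: \<sigma>_def inQ)
    have pQ: "p \<in> Q"
      unfolding inQ
    proof (intro conjI ballI)
      show "p \<in> affine hull Q" unfolding p_def by (rule aff)
      fix k assume k: "k \<in> H"
      have kq: "a k \<bullet> q \<le> b k" using q k by (simp add: inQ)
      \<comment> \<open>An inequality in \<open>H'\<close> holds up to its own time
        \<open>\<sigma> k\<close>, which is not before \<open>\<sigma> h\<close>; the others cannot
        get worse on the way forward.\<close>
      show "a k \<bullet> p \<le> b k"
      proof (cases "a k \<bullet> w > 0")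
        case True
        then have "\<sigma> h \<le> \<sigma> k" using hmin k by (simp add: H'_def)
        then have "\<sigma> h * (a k \<bullet> w) \<le> \<sigma> k * (a k \<bullet> w)" using True by (intro mult_right_mono) auto
        also have "\<dots> = b k - a k \<bullet> q" using True by (simp add: \<sigma>_def)
        finally show ?thesis by (simp add: p_def inner_add_right)
      next
        case False
        then have "\<sigma> h * (a k \<bullet> w) \<le> 0" using \<sigma>0 by (simp add: mult_nonneg_nonpos)
        then show ?thesis using kq by (simp add: p_def inner_add_right)
      qed
    qed
    define C where "C = Q \<inter> {x. a h \<bullet> x = b h}"
    have "Q \<subseteq> {x. a h \<bullet> x \<le> b h}" using hH inQ by blast
    then have "C \<in> front Q w" using hH hw facet unfolding front_def C_def by blast
    moreover have "p \<in> C" using pQ hw by (simp add: C_def p_def \<sigma>_def inner_add_right)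
    moreover have "p + (u - \<sigma> h) *\<^sub>R w = x" by (simp add: x p_def algebra_simps)
    moreover have "(u - \<sigma> h) *\<^sub>R w \<in> closed_segment 0 w"
      unfolding in_closed_segment_0 using \<sigma>0 su hmin[OF h0'] u
      by (intro exI[of _ "u - \<sigma> h"]) auto
    ultimately have "x \<in> C + closed_segment 0 w" by (metis set_plus_intro)
    then show ?thesis using \<open>C \<in> front Q w\<close> by blast
  qed auto
qed

lemma compact_set_plus:
  fixes A B :: "'a::real_normed_vector set"
  assumes "compact A" "compact B" shows "compact (A + B)"
proof -
  have "A + B = {x + y |x y. x \<in> A \<and> y \<in> B}" by (auto simp: set_plus_def)
  then show ?thesis using compact_sums[OF assms] by simp
qed

text \<open>Directness of the sum of \<open>T\<close> and \<open>W\<close>. Only the difference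
  \<open>x - y\<close> has to lie in \<open>T\<close>, so that the lemma applies to points of a
  polytope with directions in \<open>T\<close>.\<close>

lemma set_plus_unique:
  assumes "subspace T" "subspace W" "T \<inter> W = {0}" 
    and "x + z = y + z'" "x - y \<in> T" "z \<in> W" "z' \<in> W"
  shows "x = y" "z = z'"
proof -
  have eq: "x - y = z' - z" using assms(4) by (simp add: algebra_simps)
  have "z' - z \<in> W" using assms(2,6,7) by (simp add: subspace_diff)
  then have "x - y \<in> T \<inter> W" using assms(5) eq by simp
  then have "x - y = 0" using assms(3) by blast
  then show "x = y" "z = z'" using eq by simp_all
qed

subsection \<open>Sweeping a polytope along a segment\<close>

lemma front_facet:
  assumes "C \<in> front Q w"
  shows "C facet_of Q" "C face_of Q" "C \<subseteq> Q" "aff_dim C = aff_dim Q - 1"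
    "\<exists>a b. a \<bullet> w > 0 \<and> C = Q \<inter> {x. a \<bullet> x = b} \<and> Q \<subseteq> {x. a \<bullet> x \<le> b}"
  using assms by (auto simp: front_def facet_of_def)

lemma finite_front: "polytope Q \<Longrightarrow> finite (front Q w)"
  by (rule finite_subset[OF _ finite_polytope_faces[of Q]]) (auto simp: front_def facet_of_def)

text \<open>Distinct facets have equal dimension, so neither contains the other; their intersection
  is a proper face of \<open>C\<close> and loses a second dimension.\<close>

lemma aff_dim_front_Int:
  assumes "polytope Q" "C \<in> front Q w" "D \<in> front Q w" "C \<noteq> D"
  shows "aff_dim (C \<inter> D) \<le> aff_dim Q - 2"
proof -
  have C: "C face_of Q" "aff_dim C = aff_dim Q - 1" and D: "D face_of Q" "aff_dim D = aff_dim Q - 1"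
    using assms by (simp_all add: front_facet)
  have conv: "convex C" "convex D" 
    using C D face_of_imp_convex assms(1) polytope_imp_convex by blast+
  have CD: "C \<inter> D face_of C" "C \<inter> D face_of D"
    using face_of_subset[OF face_of_Int[OF C(1) D(1)]] C D face_of_imp_subset by auto
  have "C \<inter> D \<noteq> C"
  proof
    assume "C \<inter> D = C"
    then have "aff_dim C < aff_dim D" using face_of_aff_dim_lt[OF conv(2), of C] CD(2) assms(4) by simp
    then show False using C D by simp
  qed
  then have "aff_dim (C \<inter> D) < aff_dim C" using face_of_aff_dim_lt[OF conv(1) CD(1)] by simp
  then show ?thesis using C by simp
qed

text \<open>
  A discrete divergence theorem: translating \<open>Q\<close> along the segment from 0 to \<open>w\<close> adds
  exactly the prisms over the front facets, up to null sets. The transversal factor \<open>Z\<close> makes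
  everything full-dimensional, so that integrals over faces never require lower-dimensional
  measures.
\<close>

lemma integral_sweep:
  fixes Q :: "'a::euclidean_space set" and f :: "'a \<Rightarrow> 'b::euclidean_space"
  assumes Q: "polytope Q" "Q \<noteq> {}" and w: "w \<in> lin Q"
    and W: "subspace W" "lin Q \<inter> W = {0}" "int (dim W) + aff_dim Q \<le> int DIM('a)"
    and Z: "compact Z" "Z \<subseteq> W" and f: "continuous_on UNIV f"
  shows "integral (Q + (closed_segment 0 w + Z)) f
    = integral (Q + Z) f + (\<Sum>C\<in>front Q w. integral (C + (closed_segment 0 w + Z)) f)"
proof -
  let ?S = "closed_segment 0 w"
  define N where "N C = C + (?S + Z)" for C
  have L: "subspace (lin Q)" by (rule subspace_lin) fact
  have fin: "finite (front Q w)" by (rule finite_front) fact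
  have memN: "\<exists>c u z. x = (c + u *\<^sub>R w) + z \<and> c \<in> C \<and> 0 \<le> u \<and> u \<le> 1 \<and> z \<in> Z" if "x \<in> N C" for x C
  proof -
    from that obtain c y' where c: "x = c + y'" "c \<in> C" and "y' \<in> ?S + Z"
      unfolding N_def by (rule set_plus_elim)
    from this(3) obtain y z where y: "y' = y + z" "y \<in> ?S" "z \<in> Z" by (rule set_plus_elim)
    from y(2) obtain u where "0 \<le> u" "u \<le> 1" "y = u *\<^sub>R w" by (auto simp: in_closed_segment_0)
    then have "x = (c + u *\<^sub>R w) + z" using c y by (simp add: add.assoc)
    then show ?thesis using c y \<open>0 \<le> u\<close> \<open>u \<le> 1\<close> by blast
  qed
  have inL: "(c + u *\<^sub>R w) - (d + v *\<^sub>R w) \<in> lin Q" if "c \<in> Q" "d \<in> Q" for c d u v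
  proof -
    have "(c - d) + (u - v) *\<^sub>R w \<in> lin Q"
      by (intro subspace_add[OF L] subspace_scale[OF L] w diff_in_lin that)
    then show ?thesis by (simp add: algebra_simps)
  qed
  have cQ: "compact Q" using Q polytope_imp_compact by blast
  have cC: "compact C" if "C \<in> front Q w" for C
    using front_facet(2)[OF that] Q cQ face_of_imp_compact polytope_imp_convex by blast
  have cS: "compact (?S + Z)" by (intro compact_set_plus Z) auto
  have integ: "(f has_integral (integral K f)) K" if "compact K" for K
    using integral_compact_lborel(1)[OF that continuous_on_subset[OF f]] by (simp add: integrable_integral)
  have neg1: "negligible (N C \<inter> N D)" if C: "C \<in> front Q w" and D: "D \<in> front Q w" and ne: "C \<noteq> D" for C D
  proof -
    \<comment> \<open>The two prisms overlap inside \<open>C \<inter> D\<close> thickened by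
      \<open>W\<close> and \<open>w\<close>: the codimension 2 of \<open>C \<inter> D\<close> in
      \<open>Q\<close> outweighs the one extra direction \<open>w\<close>.\<close>
    define W' where "W' = span (insert w W)"
    have "dim W' \<le> dim W + 1" by (simp add: W'_def dim_insert)
    then have "aff_dim (C \<inter> D) + int (dim W') < int DIM('a)"
      using aff_dim_front_Int[OF Q(1) C D ne] W(3) by linarith
    then have "negligible ((C \<inter> D) + W')"
      by (intro negligible_plus_subspace) (auto simp: W'_def)
    moreover have "N C \<inter> N D \<subseteq> (C \<inter> D) + W'"
    proof
      fix x assume x: "x \<in> N C \<inter> N D"
      obtain c u z where c: "x = (c + u *\<^sub>R w) + z" "c \<in> C" "0 \<le> u" "u \<le> 1" "z \<in> Z"
        using memN x by blast
      obtain d v z' where d: "x = (d + v *\<^sub>R w) + z'" "d \<in> D" "0 \<le> v" "v \<le> 1" "z' \<in> Z"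
        using memN x by blast
      have cd: "c \<in> Q" "d \<in> Q" using c d front_facet(3) C D by blast+
      have eq: "c + u *\<^sub>R w = d + v *\<^sub>R w"
        by (rule set_plus_unique(1)[OF L W(1,2), of _ z _ z']) (use c d Z inL cd in auto)
      obtain a b where a: "a \<bullet> w > 0" "C = Q \<inter> {x. a \<bullet> x = b}" "Q \<subseteq> {x. a \<bullet> x \<le> b}"
        using front_facet(5)[OF C] by blast
      obtain a' b' where a': "a' \<bullet> w > 0" "D = Q \<inter> {x. a' \<bullet> x = b'}" "Q \<subseteq> {x. a' \<bullet> x \<le> b'}"
        using front_facet(5)[OF D] by blast
      \<comment> \<open>\<open>a\<close> is maximal over \<open>Q\<close> on \<open>C\<close>, and
        \<open>a'\<close> on \<open>D\<close>. The first bounds \<open>u\<close> by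
        \<open>v\<close>, the second \<open>v\<close> by \<open>u\<close>, so the base points
        \<open>c\<close> and \<open>d\<close> coincide.\<close>
      have "a \<bullet> (c + u *\<^sub>R w) = a \<bullet> (d + v *\<^sub>R w)" "a' \<bullet> (c + u *\<^sub>R w) = a' \<bullet> (d + v *\<^sub>R w)"
        using eq by simp_all
      moreover have "a \<bullet> c = b" "a \<bullet> d \<le> b" "a' \<bullet> d = b'" "a' \<bullet> c \<le> b'"
        using a a' c d cd by blast+
      ultimately have "u * (a \<bullet> w) \<le> v * (a \<bullet> w)" "v * (a' \<bullet> w) \<le> u * (a' \<bullet> w)"
        by (simp_all add: inner_add_right)
      then have "u = v" using a(1) a'(1) by (simp add: mult_le_cancel_right)
      then have "c \<in> C \<inter> D" using eq c d by simp
      moreover have "u *\<^sub>R w + z \<in> W'"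
        unfolding W'_def using c Z(2) by (intro span_add span_scale) (auto intro: span_base)
      ultimately have "c + (u *\<^sub>R w + z) \<in> (C \<inter> D) + W'" by (rule set_plus_intro)
      then show "x \<in> (C \<inter> D) + W'" using c by (simp add: add.assoc)
    qed
    ultimately show ?thesis using negligible_subset by blast
  qed
  have neg2: "negligible ((Q + Z) \<inter> N C)" if C: "C \<in> front Q w" for C
  proof -
    have "negligible (C + W)"
      by (rule negligible_plus_subspace) (use W front_facet(4)[OF C] in auto)
    moreover have "(Q + Z) \<inter> N C \<subseteq> C + W"
    proof
      fix x assume x: "x \<in> (Q + Z) \<inter> N C"
      obtain c u z where c: "x = (c + u *\<^sub>R w) + z" "c \<in> C" "0 \<le> u" "u \<le> 1" "z \<in> Z"
        using memN x by blast
      obtain q z' where q: "x = q + z'" "q \<in> Q" "z' \<in> Z" using x by (blast elim: set_plus_elim)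
      have cQ: "c \<in> Q" using c front_facet(3) C by blast
      have eq: "c + u *\<^sub>R w = q"
        by (rule set_plus_unique(1)[OF L W(1,2), of _ z _ z'])
          (use c q Z inL[of c q u 0] cQ in auto)
      obtain a b where a: "a \<bullet> w > 0" "C = Q \<inter> {x. a \<bullet> x = b}" "Q \<subseteq> {x. a \<bullet> x \<le> b}"
        using front_facet(5)[OF C] by blast
      \<comment> \<open>\<open>a\<close> already has its maximum over \<open>Q\<close> on
        \<open>C\<close> and grows along \<open>w\<close>, so only \<open>u = 0\<close> stays in
        \<open>Q\<close>.\<close>
      have "a \<bullet> (c + u *\<^sub>R w) \<le> b" "a \<bullet> c = b" using eq q a c by blast+
      then have "u * (a \<bullet> w) \<le> 0" by (simp add: inner_add_right)
      then have "u = 0" using a(1) c(3) by (simp add: mult_le_0_iff)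
      then have "x = c + z" using c by simp
      then show "x \<in> C + W" using c Z by (auto intro: set_plus_intro)
    qed
    ultimately show ?thesis using negligible_subset by blast
  qed
  have un: "Q + (?S + Z) = (Q + Z) \<union> (\<Union>C\<in>front Q w. N C)"
  proof
    show "Q + (?S + Z) \<subseteq> (Q + Z) \<union> (\<Union>C\<in>front Q w. N C)"
    proof
      fix x assume "x \<in> Q + (?S + Z)"
      then have "x \<in> (Q + ?S) + Z" by (simp add: add.assoc)
      then obtain y z where y: "x = y + z" "y \<in> Q + ?S" "z \<in> Z" by (rule set_plus_elim)
      then have "y \<in> Q \<union> (\<Union>C\<in>front Q w. C + ?S)" using polytope_sweep_front[OF Q(1) w] by blast
      then consider "y \<in> Q" | C where "C \<in> front Q w" "y \<in> C + ?S" by blast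
      then show "x \<in> (Q + Z) \<union> (\<Union>C\<in>front Q w. N C)"
      proof cases
        case 1 then show ?thesis using y by (auto intro: set_plus_intro)
      next
        case 2
        then have "x \<in> N C" unfolding N_def using y 
          by (metis add.assoc set_plus_intro)
        then show ?thesis using 2 by blast
      qed
    qed
    have "Q + Z \<subseteq> Q + (?S + Z)"
    proof -
      have "Z \<subseteq> ?S + Z" using set_plus_intro[of 0 ?S _ Z] by fastforce
      then show ?thesis by (intro set_plus_mono2) auto
    qed
    moreover have "N C \<subseteq> Q + (?S + Z)" if "C \<in> front Q w" for C
      unfolding N_def using front_facet(3)[OF that] by (intro set_plus_mono2) auto
    ultimately show "(Q + Z) \<union> (\<Union>C\<in>front Q w. N C) \<subseteq> Q + (?S + Z)" by blast
  qed
  have "(f has_integral (\<Sum>C\<in>front Q w. integral (N C) f)) (\<Union>C\<in>front Q w. N C)"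
    by (rule has_integral_UN[OF fin])
      (auto simp: pairwise_def N_def[symmetric] intro!: neg1 integ compact_set_plus[OF cC cS, folded N_def])
  moreover have "negligible ((Q + Z) \<inter> (\<Union>C\<in>front Q w. N C))"
    unfolding Int_UN_distrib using fin neg2 by (intro negligible_Union) auto
  ultimately have "(f has_integral (integral (Q + Z) f + (\<Sum>C\<in>front Q w. integral (N C) f)))
      ((Q + Z) \<union> (\<Union>C\<in>front Q w. N C))"
    by (intro has_integral_Un integ compact_set_plus cQ Z)
  then show ?thesis unfolding un[symmetric] by (simp add: integral_unique N_def)
qed

text \<open>Sums over the front facets of the scaled polytope can thus be indexed by those of
  \<open>Q\<close>, independently of \<open>s\<close>. One inclusion for all positive factors
  suffices, since the factor \<open>1 / s\<close> undoes the scaling.\<close>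

lemma front_scale:
  assumes s: "s > 0"
  shows "front ((\<lambda>x. s *\<^sub>R x) ` Q) w = (\<lambda>C. (\<lambda>x. s *\<^sub>R x) ` C) ` front Q w"
proof -
  have sub: "(\<lambda>C. (\<lambda>x. s *\<^sub>R x) ` C) ` front Q w \<subseteq> front ((\<lambda>x. s *\<^sub>R x) ` Q) w"
    if s: "s > 0" for s and Q :: "'a set"
  proof
    fix D assume "D \<in> (\<lambda>C. (\<lambda>x. s *\<^sub>R x) ` C) ` front Q w"
    then obtain C where D: "D = (\<lambda>x. s *\<^sub>R x) ` C" and C: "C \<in> front Q w" by blast
    have inj: "inj (\<lambda>x::'a. s *\<^sub>R x)" using s by (simp add: inj_on_def)
    have lin: "linear (\<lambda>x::'a. s *\<^sub>R x)" by simp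
    obtain a b where a: "a \<bullet> w > 0" "C = Q \<inter> {x. a \<bullet> x = b}" "Q \<subseteq> {x. a \<bullet> x \<le> b}"
      using front_facet(5)[OF C] by blast
    have "D facet_of ((\<lambda>x. s *\<^sub>R x) ` Q)"
      using front_facet(1)[OF C] inj lin 
      unfolding facet_of_def D by (simp add: face_of_linear_image aff_dim_injective_linear_image)
    moreover have "D = ((\<lambda>x. s *\<^sub>R x) ` Q) \<inter> {x. a \<bullet> x = s * b}"
      unfolding D a(2) using s by auto
    moreover have "((\<lambda>x. s *\<^sub>R x) ` Q) \<subseteq> {x. a \<bullet> x \<le> s * b}"
      using a(3) s by auto
    ultimately show "D \<in> front ((\<lambda>x. s *\<^sub>R x) ` Q) w" unfolding front_def using a(1) by blast
  qed
  show ?thesis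
  proof (rule antisym[OF _ sub[OF s]])
    have inv: "(\<lambda>x. s *\<^sub>R x) ` (\<lambda>x. (1 / s) *\<^sub>R x) ` X = X" "(\<lambda>x. (1 / s) *\<^sub>R x) ` (\<lambda>x. s *\<^sub>R x) ` X = X"
      for X :: "'a set" using s by (auto simp: image_image)
    have "(\<lambda>C. (\<lambda>x. (1 / s) *\<^sub>R x) ` C) ` front ((\<lambda>x. s *\<^sub>R x) ` Q) w
        \<subseteq> front ((\<lambda>x. (1 / s) *\<^sub>R x) ` (\<lambda>x. s *\<^sub>R x) ` Q) w"
      using s by (intro sub) simp
    then have *: "(\<lambda>x. (1 / s) *\<^sub>R x) ` D \<in> front Q w" if "D \<in> front ((\<lambda>x. s *\<^sub>R x) ` Q) w" for D
      using that unfolding inv(2) by blast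
    show "front ((\<lambda>x. s *\<^sub>R x) ` Q) w \<subseteq> (\<lambda>C. (\<lambda>x. s *\<^sub>R x) ` C) ` front Q w"
    proof
      fix D assume "D \<in> front ((\<lambda>x. s *\<^sub>R x) ` Q) w"
      from *[OF this] show "D \<in> (\<lambda>C. (\<lambda>x. s *\<^sub>R x) ` C) ` front Q w"
        by (rule rev_image_eqI) (simp add: inv(1))
    qed
  qed
qed

subsection \<open>Scaling along a subspace\<close>

text \<open>The factor from \<open>integral_compact_linear_image\<close> is common to all compact
  sets and integrands, so integrating the constant 1 over the unit cube determines it.\<close>

lemma integral_stretch_Basis:
  fixes f :: "'a::euclidean_space \<Rightarrow> complex"
  assumes m: "\<And>i. i \<in> Basis \<Longrightarrow> m i > 0" and K: "compact K" and f: "continuous_on UNIV f"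
  defines "D \<equiv> \<lambda>x::'a. \<Sum>i\<in>Basis. (m i * (x \<bullet> i)) *\<^sub>R i"
  shows "integral (D ` K) f = (\<Prod>i\<in>Basis. m i) *\<^sub>R integral K (\<lambda>x. f (D x))"
proof -
  have lin: "linear D"
    unfolding D_def by (intro linearI) (simp_all add: algebra_simps sum.distrib scaleR_sum_right)
  have "inj D"
  proof (rule injI)
    fix x y assume "D x = D y"
    moreover have "D z \<bullet> i = m i * (z \<bullet> i)" if "i \<in> Basis" for i z
      using that by (simp add: D_def)
    ultimately have eq: "m i * (x \<bullet> i) = m i * (y \<bullet> i)" if "i \<in> Basis" for i
      using that by metis
    show "x = y" by (rule euclidean_eqI) (metis eq m less_irrefl mult_cancel_left)
  qed
  then have "bij D" using lin by (simp add: bij_def linear_injective_imp_surjective)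
  from integral_compact_linear_image[OF lin this] obtain c where
    c: "\<And>K (f :: 'a \<Rightarrow> complex). \<lbrakk>compact K; continuous_on UNIV f\<rbrakk> \<Longrightarrow>
      integral (D ` K) f = c *\<^sub>R integral K (\<lambda>x. f (D x))" by blast
  have "measure lborel (D ` cbox 0 (\<Sum>Basis)) = (\<Prod>i\<in>Basis. m i) * measure lborel (cbox 0 (\<Sum>Basis :: 'a))"
    unfolding D_def content_image_stretch_interval using m by (simp add: prod_pos abs_of_pos)
  moreover obtain a b where ab: "D ` cbox 0 (\<Sum>Basis) = cbox a b"
    unfolding D_def image_stretch_interval by (metis empty_as_interval)
  moreover have "measure lborel (cbox 0 (\<Sum>Basis :: 'a)) = 1"
    by (subst content_cbox) auto
  ultimately have cp: "measure lborel (cbox a b) = (\<Prod>i\<in>Basis. m i)" by simp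
  have "integral (D ` cbox 0 (\<Sum>Basis)) (\<lambda>_. 1 :: complex) = c *\<^sub>R integral (cbox 0 (\<Sum>Basis :: 'a)) (\<lambda>_. 1 :: complex)"
    by (rule c) auto
  then have "measure lborel (cbox a b) *\<^sub>R (1::complex) = c *\<^sub>R (measure lborel (cbox 0 (\<Sum>Basis :: 'a)) *\<^sub>R 1)"
    unfolding ab integral_const .
  then have "(of_real (measure lborel (cbox a b)) :: complex) = of_real c"
    using \<open>measure lborel (cbox 0 (\<Sum>Basis :: 'a)) = 1\<close> by (simp add: scaleR_conv_of_real)
  then have "c = (\<Prod>i\<in>Basis. m i)" using cp by (metis of_real_eq_iff)
  then show ?thesis using c[OF K f] by simp
qed

text \<open>
  Only the exponent \<open>dim T\<close> matters here. A linear change of variables, which multiplies all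
  integrals by one unknown constant, moves \<open>T\<close> to a coordinate subspace, where the scaling
  factor is explicit.
\<close>

lemma integral_scale_along_subspace:
  fixes T W :: "'a::euclidean_space set" and f :: "'a \<Rightarrow> complex"
  assumes T: "subspace T" and W: "subspace W" and TW: "T \<inter> W = {0}" "dim T + dim W = DIM('a)"
    and A: "compact A" "A \<subseteq> T" and Z: "compact Z" "Z \<subseteq> W"
    and f: "continuous_on UNIV f" and f_inv: "\<And>x z. x \<in> T \<Longrightarrow> f (x + z) = f z"
  obtains c where "\<And>s. s > 0 \<Longrightarrow> integral ((\<lambda>x. s *\<^sub>R x) ` A + Z) f = s ^ dim T *\<^sub>R c"
proof -
  have "dim T \<le> card (Basis :: 'a set)" using TW(2) by simp
  then obtain J where J: "J \<subseteq> (Basis :: 'a set)" "card J = dim T"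
    by (meson obtain_subset_with_card_n)
  define J' where "J' = Basis - J"
  have J': "J' \<subseteq> Basis" "card J' = dim W" "finite J" "finite J'" "J \<inter> J' = {}" "J \<union> J' = Basis"
    using J TW(2) finite_subset[OF J(1)] by (auto simp: J'_def card_Diff_subset)
  define U where "U I = {x::'a. \<forall>i\<in>Basis. i \<notin> I \<longrightarrow> x \<bullet> i = 0}" for I
  have subU: "subspace (U I)" for I unfolding U_def by (rule subspace_substandard)
  have dimU: "dim (U I) = card I" if "I \<subseteq> Basis" for I unfolding U_def by (rule dim_substandard[OF that])
  \<comment> \<open>\<open>p\<close> and \<open>q\<close> carry complementary coordinate subspaces
    onto \<open>T\<close> and \<open>W\<close>; \<open>g\<close> will combine them into a linear
    bijection of the whole space.\<close>
  obtain p where p: "linear p" "p ` U J = T" "inj_on p (U J)"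
    using subspace_isomorphism[OF subU T] dimU[OF J(1)] J(2) by metis
  obtain q where q: "linear q" "q ` U J' = W" "inj_on q (U J')"
    using subspace_isomorphism[OF subU W] dimU[OF J'(1)] J'(2) by metis
  define \<pi> where "\<pi> I x = (\<Sum>i\<in>I. (x \<bullet> i) *\<^sub>R i)" for I and x :: 'a
  have \<pi>_lin: "linear (\<pi> I)" for I
    unfolding \<pi>_def by (intro linearI) (simp_all add: algebra_simps sum.distrib scaleR_sum_right)
  have \<pi>U: "\<pi> I x \<in> U I" if "I \<subseteq> Basis" for I x
  proof -
    have "k \<bullet> i = 0" if "k \<in> I" "i \<in> Basis" "i \<notin> I" for i k
      using that \<open>I \<subseteq> Basis\<close> by (metis inner_not_same_Basis subsetD)
    then show ?thesis
      unfolding U_def \<pi>_def mem_Collect_eq inner_sum_left by (intro ballI impI sum.neutral) simp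
  qed
  have \<pi>_sum: "\<pi> J x + \<pi> J' x = x" for x
    using J' euclidean_representation[of x] unfolding \<pi>_def
    by (subst sum.union_disjoint[symmetric]) auto
  define g where "g x = p (\<pi> J x) + q (\<pi> J' x)" for x
  have pT: "p (\<pi> J x) \<in> T" and qW: "q (\<pi> J' x) \<in> W" for x
    using \<pi>U[OF J(1)] \<pi>U[OF J'(1)] p(2) q(2) by blast+
  have glin: "linear g"
    unfolding g_def
    by (intro linear_compose_add linear_compose[OF \<pi>_lin p(1), unfolded o_def]
        linear_compose[OF \<pi>_lin q(1), unfolded o_def])
  have split: "p (\<pi> J y) = x" "q (\<pi> J' y) = z" if "g y = x + z" "x \<in> T" "z \<in> W" for x y z
  proof -
    have eq: "p (\<pi> J y) + q (\<pi> J' y) = x + z" using that(1) by (simp add: g_def)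
    have "p (\<pi> J y) - x \<in> T" by (rule subspace_diff[OF T pT that(2)])
    from set_plus_unique[OF T W TW(1) eq this qW that(3)]
    show "p (\<pi> J y) = x" "q (\<pi> J' y) = z" .
  qed
  have "inj g"
  proof (rule injI)
    fix x y assume "g x = g y"
    then have "g x = p (\<pi> J y) + q (\<pi> J' y)" by (simp add: g_def)
    from split[OF this pT qW] have "\<pi> J x = \<pi> J y" "\<pi> J' x = \<pi> J' y"
      using inj_onD[OF p(3) _ \<pi>U[OF J(1)] \<pi>U[OF J(1)]] inj_onD[OF q(3) _ \<pi>U[OF J'(1)] \<pi>U[OF J'(1)]]
      by blast+
    then show "x = y" using \<pi>_sum by metis
  qed
  then have bij: "bij g" using glin by (simp add: bij_def linear_injective_imp_surjective)
  from integral_compact_linear_image[OF glin bij] obtain c where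
    c: "\<And>K (f :: 'a \<Rightarrow> complex). \<lbrakk>compact K; continuous_on UNIV f\<rbrakk> \<Longrightarrow>
      integral (g ` K) f = c *\<^sub>R integral K (\<lambda>x. f (g x))" by blast
  have gcont: "continuous_on UNIV g" using glin by (simp add: linear_continuous_on linear_linear)
  obtain h where h: "linear h" "h \<circ> g = id" using linear_injective_left_inverse[OF glin \<open>inj g\<close>] by blast
  have hg: "h (g x) = x" for x using h(2) by (metis comp_apply id_apply)
  have gh: "g (h x) = x" for x
  proof -
    obtain y where "x = g y" using bij by (meson bij_pointE)
    then show ?thesis by (simp add: hg)
  qed
  define K where "K = h ` (A + Z)"
  have cK: "compact K" 
    unfolding K_def using h(1) 
    by (intro compact_continuous_image compact_set_plus A Z) (simp add: linear_continuous_on linear_linear)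
  have "integral ((\<lambda>x. s *\<^sub>R x) ` A + Z) f = s ^ dim T *\<^sub>R (c *\<^sub>R integral K (\<lambda>x. f (g x)))"
    if s: "s > 0" for s
  proof -
    \<comment> \<open>\<open>D\<close> stretches only the coordinates in \<open>J\<close>; seen
      through \<open>g\<close>, it multiplies the \<open>T\<close> component by \<open>s\<close> and
      fixes the \<open>W\<close> component.\<close>
    define m where "m i = (if i \<in> J then s else 1)" for i :: 'a
    define D where "D x = (\<Sum>i\<in>Basis. (m i * (x \<bullet> i)) *\<^sub>R i)" for x :: 'a
    have \<pi>D: "\<pi> J (D x) = s *\<^sub>R \<pi> J x" "\<pi> J' (D x) = \<pi> J' x" for x
    proof -
      have D_inner: "D x \<bullet> i = m i * (x \<bullet> i)" if "i \<in> Basis" for i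
        using that by (simp add: D_def)
      show "\<pi> J (D x) = s *\<^sub>R \<pi> J x"
        unfolding \<pi>_def scaleR_sum_right
      proof (rule sum.cong)
        fix i assume "i \<in> J"
        then have "D x \<bullet> i = s * (x \<bullet> i)" using D_inner[of i] J(1) by (auto simp: m_def)
        then show "(D x \<bullet> i) *\<^sub>R i = s *\<^sub>R (x \<bullet> i) *\<^sub>R i" by simp
      qed simp
      show "\<pi> J' (D x) = \<pi> J' x"
        unfolding \<pi>_def
      proof (rule sum.cong)
        fix i assume "i \<in> J'"
        then have "i \<in> Basis" "i \<notin> J" by (auto simp: J'_def)
        then have "D x \<bullet> i = x \<bullet> i" using D_inner[of i] by (simp add: m_def)
        then show "(D x \<bullet> i) *\<^sub>R i = (x \<bullet> i) *\<^sub>R i" by simp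
      qed simp
    qed
    have gD: "g (D y) = s *\<^sub>R x + z" if "g y = x + z" "x \<in> T" "z \<in> W" for x y z
      using split[OF that] p(1) by (simp add: g_def \<pi>D linear_scale)
    have "(\<lambda>x. s *\<^sub>R x) ` A + Z = g ` D ` K"
    proof (intro subset_antisym subsetI)
      fix x assume "x \<in> (\<lambda>x. s *\<^sub>R x) ` A + Z"
      then obtain y z where "x = s *\<^sub>R y + z" and yz: "y \<in> A" "z \<in> Z" by (auto elim!: set_plus_elim)
      moreover have "y \<in> T" "z \<in> W" using yz A Z by blast+
      ultimately have "x = g (D (h (y + z)))" using gD[OF gh] by simp
      then show "x \<in> g ` D ` K" using yz unfolding K_def by (intro image_eqI) (auto intro: set_plus_intro)
    next
      fix x assume "x \<in> g ` D ` K"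
      then obtain w where w: "w \<in> A + Z" "x = g (D (h w))" by (auto simp: K_def)
      from w(1) obtain y z where yz: "w = y + z" "y \<in> A" "z \<in> Z" by (rule set_plus_elim)
      then have "y \<in> T" "z \<in> W" using A Z by blast+
      then have "x = s *\<^sub>R y + z" using gD[OF gh] w(2) yz(1) by simp
      then show "x \<in> (\<lambda>x. s *\<^sub>R x) ` A + Z" using yz by (auto intro: set_plus_intro)
    qed
    moreover have "compact (D ` K)"
      by (intro compact_continuous_image cK) (auto simp: D_def intro!: continuous_intros)
    moreover have fg: "continuous_on UNIV (\<lambda>x. f (g x))" 
      using continuous_on_compose2[OF f gcont] by simp
    ultimately have "integral ((\<lambda>x. s *\<^sub>R x) ` A + Z) f = c *\<^sub>R integral (D ` K) (\<lambda>x. f (g x))"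
      using c[of "D ` K", OF _ f] by simp
    also have "integral (D ` K) (\<lambda>x. f (g x)) = (\<Prod>i\<in>Basis. m i) *\<^sub>R integral K (\<lambda>x. f (g (D x)))"
      unfolding D_def by (rule integral_stretch_Basis[OF _ cK fg]) (simp add: m_def s)
    \<comment> \<open>\<open>f\<close> ignores the \<open>T\<close> component, so the stretching
      leaves the integrand unchanged and only the volume factor remains.\<close>
    also have "integral K (\<lambda>x. f (g (D x))) = integral K (\<lambda>x. f (g x))"
    proof (rule integral_cong)
      fix y assume "y \<in> K"
      then obtain w where w: "w \<in> A + Z" "y = h w" unfolding K_def by blast
      from w(1) obtain x z where xz: "x \<in> A" "z \<in> Z" and "w = x + z" by (metis set_plus_elim)
      then have gy: "g y = x + z" using w(2) gh by simp
      have xT: "x \<in> T" "z \<in> W" using xz A Z by blast+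
      then have "f (g (D y)) = f z" using gD[OF gy] f_inv subspace_scale[OF T] by simp
      also have "\<dots> = f (g y)" using gy xT f_inv by simp
      finally show "f (g (D y)) = f (g y)" .
    qed
    also have "(\<Prod>i\<in>Basis. m i) = s ^ dim T"
    proof -
      have "(\<Prod>i\<in>Basis. m i) = (\<Prod>i\<in>J. m i) * (\<Prod>i\<in>J'. m i)"
        using J' by (subst prod.union_disjoint[symmetric]) auto
      also have "(\<Prod>i\<in>J'. m i) = 1" using J'(5) by (intro prod.neutral) (auto simp: m_def)
      also have "(\<Prod>i\<in>J. m i) = s ^ dim T" using J(2) by (simp add: m_def)
      finally show ?thesis by simp
    qed
    finally show ?thesis by (simp add: mult.commute)
  qed
  then show thesis by (rule that)
qed

subsection \<open>Exponential integrals over polytopes\<close>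

text \<open>The integrand of \<open>Phi\<close>, a character of the additive group of the
  space.\<close>

definition wave :: "'a::euclidean_space \<Rightarrow> 'a \<Rightarrow> complex" where
  "wave l x = exp (2 * complex_of_real pi * \<i> * complex_of_real (l \<bullet> x))"

lemma wave_add: "wave l (x + y) = wave l x * wave l y"
  by (simp add: wave_def inner_add_right ring_distribs flip: exp_add)

lemma continuous_on_wave: "continuous_on S (wave l)"
  unfolding wave_def by (intro continuous_intros)

lemma norm_wave: "norm (wave l x) = 1"
  by (simp add: wave_def norm_exp_eq_Re)

lemma wave_orthogonal: "l \<bullet> x = 0 \<Longrightarrow> wave l x = 1"
  by (simp add: wave_def)

lemma wave_half: assumes "l \<bullet> x = 1 / 2" shows "wave l x = - 1"
  unfolding wave_def assms by simp

lemma wave_Ints: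
  assumes "l \<bullet> x \<in> \<int>" shows "wave l x = 1"
proof -
  obtain k where "l \<bullet> x = of_int k" using assms by (auto elim: Ints_cases)
  then show ?thesis
    unfolding wave_def exp_eq_1 by (auto intro!: exI[of _ k])
qed

lemma integral_wave_translate:
  assumes "compact K"
  shows "integral ((+) w ` K) (wave l) = wave l w * integral K (wave l)"
  by (subst integral_compact_translation[OF assms continuous_on_wave]) (simp add: wave_add)

lemma closed_segment_0_minus: "(+) w ` closed_segment 0 (- w) = closed_segment 0 w"
  using closed_segment_translation[of w 0 "- w"] by (simp add: closed_segment_commute)

text \<open>
  Sweeping along \<open>w\<close> and along \<open>- w\<close> yields translates of the same set, and a translation
  by \<open>w\<close> multiplies the integral of the wave by -1.
\<close>

lemma integral_wave_facets:
  fixes Q :: "'a::euclidean_space set"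
  assumes Q: "polytope Q" "Q \<noteq> {}" and w: "w \<in> lin Q" and lw: "l \<bullet> w = 1 / 2"
    and W: "subspace W" "lin Q \<inter> W = {0}" "int (dim W) + aff_dim Q \<le> int DIM('a)"
    and Z: "compact Z" "Z \<subseteq> W"
  shows "integral (Q + Z) (wave l) = - 1 / 2 *
    ((\<Sum>C\<in>front Q w. integral (C + (closed_segment 0 w + Z)) (wave l)) +
     (\<Sum>C\<in>front Q (- w). integral (C + (closed_segment 0 (- w) + Z)) (wave l)))"
    (is "?I = - 1 / 2 * (?A + ?B)")
proof -
  have cQ: "compact Q" using Q polytope_imp_compact by blast
  have "- w \<in> lin Q" using w subspace_lin[OF Q(2)] by (simp add: subspace_neg)
  have "integral (Q + (closed_segment 0 w + Z)) (wave l) = ?I + ?A"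
    by (rule integral_sweep[OF Q w W Z continuous_on_wave])
  moreover have "integral (Q + (closed_segment 0 (- w) + Z)) (wave l) = ?I + ?B"
    by (rule integral_sweep[OF Q \<open>- w \<in> lin Q\<close> W Z continuous_on_wave])
  moreover have "Q + (closed_segment 0 w + Z) = (+) w ` (Q + (closed_segment 0 (- w) + Z))"
    unfolding closed_segment_0_minus[of w, symmetric] translation_eq_singleton_plus
    by (simp add: ac_simps)
  moreover have "integral ((+) w ` (Q + (closed_segment 0 (- w) + Z))) (wave l)
      = - integral (Q + (closed_segment 0 (- w) + Z)) (wave l)"
    by (subst integral_wave_translate) (auto simp: wave_half[OF lw] intro!: compact_set_plus cQ Z)
  ultimately have eq: "?I + ?A = - (?I + ?B)" by simp
  have "2 * ?I = (?I + ?A) - ?A + ?I" by simp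
  also have "\<dots> = - (?A + ?B)" unfolding eq by simp
  finally have two: "2 * ?I = - (?A + ?B)" .
  have "x = - 1 / 2 * y" if "2 * x = - y" for x y :: complex
    using arg_cong[OF that, of "\<lambda>z. z / 2"] by simp
  from this[OF two] show ?thesis .
qed

text \<open>The faces on which \<open>l\<close> is constant are the only ones that contribute.\<close>

definition level_faces :: "'a::euclidean_space \<Rightarrow> 'a set \<Rightarrow> 'a set set" where
  "level_faces l P = {F. F face_of P \<and> F \<noteq> {} \<and> (\<forall>v\<in>lin F. orthogonal l v)}"

text \<open>When \<open>l\<close> is orthogonal to \<open>lin F\<close>, the wave at
  \<open>s x\<close> is the same for all \<open>x\<close> in \<open>F\<close>. Choosing a vertex for
  \<open>x\<close> ensures that \<open>t\<close> times it is a lattice point.\<close>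

definition apex :: "'a::euclidean_space set \<Rightarrow> 'a" where
  "apex F = (SOME v. v extreme_point_of F)"

text \<open>The coefficients \<open>c F\<close> do not depend on \<open>s\<close>: all oscillation
  in \<open>s\<close> sits in the wave, which has modulus 1.\<close>

definition face_sum :: "'a::euclidean_space \<Rightarrow> 'a set \<Rightarrow> ('a set \<Rightarrow> complex) \<Rightarrow> real \<Rightarrow> complex" where
  "face_sum l P c s = (\<Sum>F\<in>level_faces l P. c F * of_real s ^ nat (aff_dim F) * wave l (s *\<^sub>R apex F))"

text \<open>Hiding the coefficients gives a class of functions closed under linear combinations. It
  asks only for \<open>s > 0\<close>, because scaling by 0 collapses the faces and their
  dimensions.\<close>

definition is_face_sum :: "'a::euclidean_space \<Rightarrow> 'a set \<Rightarrow> (real \<Rightarrow> complex) \<Rightarrow> bool" where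
  "is_face_sum l P G \<longleftrightarrow> (\<exists>c. \<forall>s>0. G s = face_sum l P c s)"

lemma finite_level_faces: "polytope P \<Longrightarrow> finite (level_faces l P)"
  by (rule finite_subset[OF _ finite_polytope_faces[of P]]) (auto simp: level_faces_def)

lemma apex_extreme:
  assumes "polytope P" "F face_of P" "F \<noteq> {}"
  shows "apex F extreme_point_of F" "apex F extreme_point_of P" "apex F \<in> F"
proof -
  have "polytope F" using assms by (meson face_of_polytope_polytope)
  then obtain v where "v extreme_point_of F"
    using extreme_point_exists_convex assms(3) polytope_imp_compact polytope_imp_convex by metis
  then show F: "apex F extreme_point_of F" unfolding apex_def by (rule someI)
  then show "apex F extreme_point_of P" using extreme_point_of_face[OF assms(2)] by blast
  show "apex F \<in> F" using F by (simp add: extreme_point_of_def)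
qed

section \<open>Linear combinations of face sums\<close>

lemma is_face_sum_add:
  assumes "is_face_sum l P G" "is_face_sum l P H" shows "is_face_sum l P (\<lambda>s. G s + H s)"
proof -
  obtain c d where "\<forall>s>0. G s = face_sum l P c s" "\<forall>s>0. H s = face_sum l P d s"
    using assms unfolding is_face_sum_def by blast
  then have "\<forall>s>0. G s + H s = face_sum l P (\<lambda>F. c F + d F) s"
    by (simp add: face_sum_def algebra_simps sum.distrib)
  then show ?thesis unfolding is_face_sum_def by blast
qed

lemma is_face_sum_cmult:
  assumes "is_face_sum l P G" shows "is_face_sum l P (\<lambda>s. a * G s)"
proof -
  obtain c where "\<forall>s>0. G s = face_sum l P c s"
    using assms unfolding is_face_sum_def by blast
  then have "\<forall>s>0. a * G s = face_sum l P (\<lambda>F. a * c F) s"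
    by (simp add: face_sum_def sum_distrib_left mult.assoc)
  then show ?thesis unfolding is_face_sum_def by blast
qed

lemma is_face_sum_sum:
  assumes "finite I" "\<And>i. i \<in> I \<Longrightarrow> is_face_sum l P (G i)"
  shows "is_face_sum l P (\<lambda>s. \<Sum>i\<in>I. G i s)"
  using assms
proof (induction I rule: finite_induct)
  case empty
  have "\<forall>s>0. (\<Sum>i\<in>{}. G i s) = face_sum l P (\<lambda>_. 0) s" by (simp add: face_sum_def)
  then show ?case unfolding is_face_sum_def by blast
next
  case (insert i I)
  then show ?case by (simp add: is_face_sum_add)
qed

lemma is_face_sum_cong:
  assumes "\<And>s. s > 0 \<Longrightarrow> G s = H s" "is_face_sum l P H" shows "is_face_sum l P G"
  using assms by (simp add: is_face_sum_def)

lemma is_face_sum_level: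
  assumes "polytope P" and F: "F \<in> level_faces l P"
    and G: "\<And>s. s > 0 \<Longrightarrow> G s = a * of_real s ^ nat (aff_dim F) * wave l (s *\<^sub>R apex F)"
  shows "is_face_sum l P G"
proof -
  have "G s = face_sum l P (\<lambda>F'. if F' = F then a else 0) s" if "s > 0" for s
  proof -
    have "face_sum l P (\<lambda>F'. if F' = F then a else 0) s
        = (\<Sum>F'\<in>level_faces l P. if F' = F then a * of_real s ^ nat (aff_dim F) * wave l (s *\<^sub>R apex F) else 0)"
      unfolding face_sum_def by (intro sum.cong) auto
    then show ?thesis using F finite_level_faces[OF assms(1)] G[OF that] by simp
  qed
  then show ?thesis unfolding is_face_sum_def by blast
qed

section \<open>Prisms over the faces of a polytope\<close>

text \<open>Moving the apex of \<open>F\<close> to the origin puts \<open>F\<close> into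
  \<open>lin F\<close>, along which the wave is invariant, so scaling yields the power of
  \<open>s\<close>. Moving back by \<open>s *\<^sub>R apex F\<close> contributes the wave at that
  point.\<close>

lemma integral_wave_prism_level:
  fixes P :: "'a::euclidean_space set"
  assumes P: "polytope P" and F: "F \<in> level_faces l P"
    and W: "subspace W" "lin F \<inter> W = {0}" "int (dim W) + aff_dim F = int DIM('a)"
    and Z: "compact Z" "Z \<subseteq> W"
  shows "is_face_sum l P (\<lambda>s. integral ((\<lambda>x. s *\<^sub>R x) ` F + Z) (wave l))"
proof -
  have FP: "F face_of P" "F \<noteq> {}" and orth: "\<And>v. v \<in> lin F \<Longrightarrow> l \<bullet> v = 0"
    using F by (auto simp: level_faces_def orthogonal_def)
  have v: "apex F \<in> F" by (rule apex_extreme[OF P FP])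
  have cF: "compact F" using face_of_polytope_polytope[OF P FP(1)] polytope_imp_compact by blast
  define A where "A = (+) (- apex F) ` F"
  have A: "compact A" unfolding A_def using compact_translation[OF cF] .
  have AT: "A \<subseteq> lin F"
  proof
    fix x assume "x \<in> A"
    then obtain y where "y \<in> F" "x = - apex F + y" unfolding A_def by blast
    then show "x \<in> lin F" using diff_in_lin[OF \<open>y \<in> F\<close> v] by simp
  qed
  have L: "subspace (lin F)" by (rule subspace_lin[OF FP(2)])
  have dim: "dim (lin F) + dim W = DIM('a)" "dim (lin F) = nat (aff_dim F)"
    using dim_lin[OF FP(2)] W(3) by linarith+
  obtain c where c: "\<And>s. s > 0 \<Longrightarrow> integral ((\<lambda>x. s *\<^sub>R x) ` A + Z) (wave l) = s ^ dim (lin F) *\<^sub>R c"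
    by (rule integral_scale_along_subspace[OF L W(1,2) dim(1) A AT Z continuous_on_wave[of UNIV l]])
      (auto simp: wave_add wave_orthogonal orth)
  show ?thesis
  proof (rule is_face_sum_level[OF P F])
    fix s :: real assume s: "s > 0"
    have "(\<lambda>x. s *\<^sub>R x) ` F = (+) (s *\<^sub>R apex F) ` (\<lambda>x. s *\<^sub>R x) ` A"
      unfolding A_def image_image by (simp add: scaleR_diff_right)
    then have "(\<lambda>x. s *\<^sub>R x) ` F + Z = (+) (s *\<^sub>R apex F) ` ((\<lambda>x. s *\<^sub>R x) ` A + Z)"
      by (simp add: translation_eq_singleton_plus add.assoc)
    moreover have "compact ((\<lambda>x. s *\<^sub>R x) ` A + Z)" by (intro compact_set_plus compact_scaling A Z)
    ultimately show "integral ((\<lambda>x. s *\<^sub>R x) ` F + Z) (wave l)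
        = c * of_real s ^ nat (aff_dim F) * wave l (s *\<^sub>R apex F)"
      by (simp add: integral_wave_translate c[OF s] dim(2) scaleR_conv_of_real mult.commute)
  qed
qed

text \<open>Induction on the dimension of \<open>F\<close>. If \<open>l\<close> is not orthogonal to
  \<open>lin F\<close>, then \<open>integral_wave_facets\<close> passes to the facets, and a
  direction moves from \<open>lin F\<close> to the complement; hence \<open>W\<close> and
  \<open>Z\<close> vary in the induction. A single point has \<open>lin F = {0}\<close> and falls
  under the orthogonal case.\<close>

lemma integral_wave_prism:
  fixes P :: "'a::euclidean_space set"
  assumes P: "polytope P" and F: "F face_of P" "F \<noteq> {}"
    and W: "subspace W" "lin F \<inter> W = {0}" "int (dim W) + aff_dim F = int DIM('a)"
    and Z: "compact Z" "Z \<subseteq> W"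
  shows "is_face_sum l P (\<lambda>s. integral ((\<lambda>x. s *\<^sub>R x) ` F + Z) (wave l))"
  using F W Z
proof (induction "nat (aff_dim F)" arbitrary: F W Z rule: less_induct)
  case less
  note F = less.prems(1,2) and W = less.prems(3-5) and Z = less.prems(6,7)
  show ?case
  proof (cases "\<forall>v\<in>lin F. orthogonal l v")
    case True
    then have "F \<in> level_faces l P" using F by (simp add: level_faces_def)
    then show ?thesis by (rule integral_wave_prism_level[OF P _ W Z])
  next
    case False
    then obtain u where u: "u \<in> lin F" "l \<bullet> u \<noteq> 0" by (auto simp: orthogonal_def)
    have L: "subspace (lin F)" by (rule subspace_lin[OF F(2)])
    \<comment> \<open>With this normalisation, translation by \<open>w\<close> negates the wave.
      Since \<open>w\<close> does not depend on \<open>s\<close>, the segment added to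
      \<open>Z\<close> is not scaled.\<close>
    define w where "w = (1 / (2 * (l \<bullet> u))) *\<^sub>R u"
    have w: "w \<in> lin F" and lw: "l \<bullet> w = 1 / 2" using u L by (simp_all add: w_def subspace_scale)
    have pF: "polytope F" by (rule face_of_polytope_polytope[OF P F(1)])
    have step: "is_face_sum l P (\<lambda>s. integral ((\<lambda>x. s *\<^sub>R x) ` C + (closed_segment 0 w' + Z)) (wave l))"
      if C: "C \<in> front F w'" and w': "w' \<in> lin F" for C w'
    proof -
      obtain a b where a: "a \<bullet> w' > 0" "C = F \<inter> {x. a \<bullet> x = b}"
        using front_facet(5)[OF C] by blast
      have CP: "C face_of P" using front_facet(2)[OF C] F(1) face_of_trans by blast
      have Cne: "C \<noteq> {}" using front_facet(1)[OF C] by (simp add: facet_of_def)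
      have dC: "aff_dim C = aff_dim F - 1" by (rule front_facet(4)[OF C])
      have "aff_dim C \<ge> 0" using dim_lin[OF Cne] by (metis of_nat_0_le_iff)
      define W' where "W' = span (insert w' W)"
      have w'W: "w' \<notin> span W"
      proof
        assume "w' \<in> span W"
        then have "w' \<in> lin F \<inter> W" using w' W(1) by (simp add: span_eq_iff[THEN iffD2])
        then have "w' = 0" using W(2) by blast
        then show False using a(1) by simp
      qed
      have "dim W' = dim W + 1" using w'W by (simp add: W'_def dim_insert)
      then have dim: "int (dim W') + aff_dim C = int DIM('a)" using W(3) dC by simp
      \<comment> \<open>A common vector is a multiple of \<open>w'\<close>, because
        \<open>lin F\<close> meets \<open>W\<close> trivially. The functional \<open>a\<close>
        vanishes on \<open>lin C\<close> but is positive at \<open>w'\<close>, so the multiple is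
        0.\<close>
      have "lin C \<inter> W' \<subseteq> {0}"
      proof
        fix x assume x: "x \<in> lin C \<inter> W'"
        then obtain k where k: "x - k *\<^sub>R w' \<in> span W" by (auto simp: W'_def span_insert)
        have "x \<in> lin F" using x lin_mono[OF front_facet(3)[OF C]] by blast
        then have "x - k *\<^sub>R w' \<in> lin F" using w' L by (simp add: subspace_diff subspace_scale)
        moreover have "x - k *\<^sub>R w' \<in> W" using k W(1) by (simp add: span_eq_iff[THEN iffD2])
        ultimately have "x - k *\<^sub>R w' = 0" using W(2) by blast
        then have xk: "x = k *\<^sub>R w'" by simp
        have "a \<bullet> x = 0" using x a(2) by (intro lin_inner_eq_0[of C a b]) auto
        then show "x \<in> {0}" using a(1) xk by simp
      qed
      moreover have "0 \<in> lin C \<inter> W'"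
        using subspace_lin[OF Cne] by (simp add: W'_def subspace_0 span_zero)
      ultimately have inter: "lin C \<inter> W' = {0}" by blast
      have "closed_segment 0 w' + Z \<subseteq> W'"
      proof
        fix x assume "x \<in> closed_segment 0 w' + Z"
        then obtain y z where x: "x = y + z" "y \<in> closed_segment 0 w'" "z \<in> Z" by (rule set_plus_elim)
        then obtain k where "y = k *\<^sub>R w'" by (auto simp: in_closed_segment_0)
        then show "x \<in> W'" unfolding W'_def x(1) using x(3) Z(2)
          by (intro span_add) (auto intro: span_base span_scale)
      qed
      moreover have "subspace W'" by (simp add: W'_def)
      moreover have "compact (closed_segment 0 w' + Z)" by (intro compact_set_plus Z) simp
      moreover have "nat (aff_dim C) < nat (aff_dim F)" using dC \<open>aff_dim C \<ge> 0\<close> by simp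
      ultimately show ?thesis
        by (intro less.hyps[OF _ CP Cne _ inter dim])
    qed
    have "is_face_sum l P (\<lambda>s. - 1 / 2 *
        ((\<Sum>C\<in>front F w. integral ((\<lambda>x. s *\<^sub>R x) ` C + (closed_segment 0 w + Z)) (wave l)) +
         (\<Sum>C\<in>front F (- w). integral ((\<lambda>x. s *\<^sub>R x) ` C + (closed_segment 0 (- w) + Z)) (wave l))))"
      using w L by (intro is_face_sum_cmult is_face_sum_add is_face_sum_sum finite_front pF step)
        (simp_all add: subspace_neg)
    then show ?thesis
    proof (rule is_face_sum_cong[rotated])
      fix s :: real assume s: "s > 0"
      let ?sF = "(\<lambda>x. s *\<^sub>R x) ` F"
      have inj: "inj_on (\<lambda>C. (\<lambda>x. s *\<^sub>R x) ` C) X" for X :: "'a set set"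
        using s by (intro inj_on_image) (auto simp: inj_on_def)
      \<comment> \<open>Scaling preserves \<open>lin\<close>, so the same \<open>w\<close> and
        \<open>W\<close> serve for every \<open>s\<close>.\<close>
      have lin: "lin ?sF = lin F" using s by (simp add: lin_scale)
      have "aff_dim ?sF = aff_dim F"
        using s by (intro aff_dim_injective_linear_image) (auto simp: inj_on_def)
      then have "integral (?sF + Z) (wave l) = - 1 / 2 *
        ((\<Sum>C\<in>front ?sF w. integral (C + (closed_segment 0 w + Z)) (wave l)) +
         (\<Sum>C\<in>front ?sF (- w). integral (C + (closed_segment 0 (- w) + Z)) (wave l)))"
        using w W lin polytope_scaling[OF pF] F(2)
        by (intro integral_wave_facets[OF _ _ _ lw W(1) _ _ Z]) auto
      then show "integral (?sF + Z) (wave l) = - 1 / 2 *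
        ((\<Sum>C\<in>front F w. integral ((\<lambda>x. s *\<^sub>R x) ` C + (closed_segment 0 w + Z)) (wave l)) +
         (\<Sum>C\<in>front F (- w). integral ((\<lambda>x. s *\<^sub>R x) ` C + (closed_segment 0 (- w) + Z)) (wave l)))"
        unfolding front_scale[OF s] sum.reindex[OF inj] o_def .
    qed
  qed
qed

section \<open>Scaled full-dimensional polytopes\<close>

lemma Phi_eq_integral:
  assumes "compact K" shows "Phi l K = integral K (wave l)"
proof -
  have *: "integrable lborel (\<lambda>x. indicator K x *\<^sub>R wave l x)"
    by (rule borel_integrable_compact[OF assms continuous_on_wave])
  then have "integrable lebesgue (\<lambda>x. indicator K x *\<^sub>R wave l x)"
    by (rule integrable_completion[THEN iffD2, rotated]) (rule borel_measurable_integrable[OF *])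
  then have "set_integrable lebesgue K (wave l)" by (simp add: set_integrable_def)
  from set_lebesgue_integral_eq_integral(2)[OF this] show ?thesis
    unfolding Phi_def wave_def .
qed

text \<open>Passing to facets of facets lowers the dimension by one each time. This serves the lower
  powers of \<open>n\<close>, to which the binomial expansion of the term of a larger face also
  contributes.\<close>

lemma polytope_subface_exists:
  assumes "polytope F" "F \<noteq> {}" "int k \<le> aff_dim F"
  shows "\<exists>F'. F' face_of F \<and> aff_dim F' = int k"
  using assms
proof (induction "nat (aff_dim F)" arbitrary: F rule: less_induct)
  case less
  show ?case
  proof (cases "aff_dim F = int k")
    case True
    then show ?thesis using less.prems face_of_refl polytope_imp_convex by blast
  next
    case False
    then have pos: "int k < aff_dim F" using less.prems by simp
    then obtain C where C: "C facet_of F" using polytope_facet_exists[OF less.prems(1)] by auto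
    then have CF: "C face_of F" "C \<noteq> {}" "aff_dim C = aff_dim F - 1" by (auto simp: facet_of_def)
    have "polytope C" by (rule face_of_polytope_polytope[OF less.prems(1) CF(1)])
    then obtain F' where "F' face_of C" "aff_dim F' = int k"
      using less.hyps[of C] CF pos by auto
    then show ?thesis using CF(1) face_of_trans by blast
  qed
qed

text \<open>The scaled set lies in a ball of radius \<open>s * R\<close> and the wave has modulus 1,
  so the volume of that ball bounds the integral.\<close>

lemma integral_scale_tendsto_0:
  fixes P :: "'a::euclidean_space set"
  assumes "compact P"
  shows "((\<lambda>s. integral ((\<lambda>x. s *\<^sub>R x) ` P) (wave l)) \<longlongrightarrow> 0) (at_right 0)"
proof -
  obtain R where R: "R > 0" "P \<subseteq> cball 0 R"
    using bounded_subset_ballD[OF compact_imp_bounded[OF assms], of 0] ball_subset_cball by blast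
  have "norm (integral ((\<lambda>x. s *\<^sub>R x) ` P) (wave l)) \<le> unit_ball_vol (real DIM('a)) * (s * R) ^ DIM('a)"
    if s: "s > 0" for s
  proof -
    let ?K = "(\<lambda>x. s *\<^sub>R x) ` P"
    have K: "compact ?K" by (rule compact_scaling[OF assms])
    have "norm (integral ?K (wave l)) \<le> integral ?K (\<lambda>_. 1 :: real)"
      by (rule integral_norm_bound_integral)
        (auto simp: norm_wave intro!: integral_compact_lborel(1) K continuous_on_wave)
    also have "\<dots> \<le> integral (cball (0::'a) (s * R)) (\<lambda>_. 1 :: real)"
    proof (rule integral_subset_le)
      show "?K \<subseteq> cball 0 (s * R)" using R s by (auto simp: mult_left_mono)
    qed (auto intro!: integral_compact_lborel(1) K)
    also have "\<dots> = measure lborel (cball (0::'a) (s * R))"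
      by (subst integral_compact_lborel(2)) auto
    also have "\<dots> = unit_ball_vol (real DIM('a)) * (s * R) ^ DIM('a)"
      using R s by (subst content_cball) auto
    finally show ?thesis .
  qed
  then have bound: "\<forall>\<^sub>F s in at_right 0. norm (integral ((\<lambda>x. s *\<^sub>R x) ` P) (wave l))
      \<le> unit_ball_vol (real DIM('a)) * (s * R) ^ DIM('a)"
    by (simp add: eventually_at_right_less eventually_mono[OF eventually_at_right_less])
  have "((\<lambda>s. unit_ball_vol (real DIM('a)) * (s * R) ^ DIM('a))
      \<longlongrightarrow> unit_ball_vol (real DIM('a)) * (0 * R) ^ DIM('a)) (at_right 0)"
    by (intro tendsto_intros)
  then have "((\<lambda>s. unit_ball_vol (real DIM('a)) * (s * R) ^ DIM('a)) \<longlongrightarrow> 0) (at_right 0)"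
    by (simp add: power_0_left)
  then show ?thesis by (rule Lim_null_comparison[OF bound])
qed

text \<open>As \<open>P\<close> is full-dimensional, both the complement and the thickening are
  \<open>{0}\<close>, and the prism over \<open>P\<close> is \<open>P\<close> itself.\<close>

lemma integral_wave_scale:
  fixes P :: "'a::euclidean_space set"
  assumes P: "polytope P" "aff_dim P = int DIM('a)"
  obtains c where "\<And>s. s \<ge> 0 \<Longrightarrow> integral ((\<lambda>x. s *\<^sub>R x) ` P) (wave l) = face_sum l P c s"
proof -
  have ne: "P \<noteq> {}" using P(2) by auto
  have "is_face_sum l P (\<lambda>s. integral ((\<lambda>x. s *\<^sub>R x) ` P + {0}) (wave l))"
  proof (rule integral_wave_prism[OF P(1) _ ne])
    show "P face_of P" using P(1) face_of_refl polytope_imp_convex by blast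
    show "lin P \<inter> {0} = {0}" using subspace_0[OF subspace_lin[OF ne]] by blast
  qed (use P in \<open>auto simp: subspace_single_0\<close>)
  then obtain c where "\<And>s. s > 0 \<Longrightarrow> integral ((\<lambda>x. s *\<^sub>R x) ` P + {0}) (wave l) = face_sum l P c s"
    unfolding is_face_sum_def by blast
  moreover have "X + {0} = X" for X :: "'a set" by (simp add: set_plus_def)
  ultimately have c: "integral ((\<lambda>x. s *\<^sub>R x) ` P) (wave l) = face_sum l P c s" if "s > 0" for s
    using that by simp
  \<comment> \<open>The formula extends to \<open>s = 0\<close>, needed for \<open>n = \<epsilon> = 0\<close>, by continuity.\<close>
  have "isCont (\<lambda>s. face_sum l P c s) 0"
    unfolding face_sum_def wave_def by (intro continuous_intros)
  then have "((\<lambda>s. face_sum l P c s) \<longlongrightarrow> face_sum l P c 0) (at_right 0)"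
    unfolding isCont_def by (rule filterlim_at_split[THEN iffD1, THEN conjunct2])
  moreover have "((\<lambda>s. face_sum l P c s) \<longlongrightarrow> 0) (at_right 0)"
  proof (rule Lim_transform_eventually[OF integral_scale_tendsto_0])
    show "compact P" using P(1) by (rule polytope_imp_compact)
    show "\<forall>\<^sub>F s in at_right 0. integral ((\<lambda>x. s *\<^sub>R x) ` P) (wave l) = face_sum l P c s"
      using c by (auto intro: eventually_mono[OF eventually_at_right_less])
  qed
  ultimately have "face_sum l P c 0 = 0"
    using tendsto_unique[OF trivial_limit_at_right_real] by blast
  moreover have "integral ((\<lambda>x. 0 *\<^sub>R x) ` P) (wave l) = 0"
    using ne by (simp add: image_constant_conv)
  ultimately have "integral ((\<lambda>x. s *\<^sub>R x) ` P) (wave l) = face_sum l P c s" if "s \<ge> 0" for s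
    using c that by (cases "s = 0") auto
  then show thesis by (rule that)
qed

section \<open>Periodic coefficients and the faces that produce them\<close>

theorem theorem3p2:
  fixes \<Lambda> P :: "'a::euclidean_space set" and a l :: 'a
    and \<epsilon> :: real and t :: nat
  assumes "euclidean_lattice \<Lambda>"
    and "rational_polytope \<Lambda> P"
    and "aff_dim P = int DIM('a)"
    and "t > 0"
    and "lattice_polytope \<Lambda> ((\<lambda>x. real t *\<^sub>R x) ` P)"
    and "\<epsilon> \<in> \<rat>" and "\<epsilon> \<ge> 0"
    and "l \<in> dual_lattice \<Lambda>"
  shows "\<exists>f :: nat \<Rightarrow> nat \<Rightarrow> complex.
    (\<forall>n. Phi l ((\<lambda>x. (real n + \<epsilon>) *\<^sub>R x + a) ` P) = (\<Sum>i=0..DIM('a). f i n * of_nat n ^ i)) \<and>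
    (\<forall>n. \<forall>i\<le>DIM('a). f i (n + t) = f i n) \<and>
    (\<forall>k\<le>DIM('a). (\<exists>n. f (DIM('a) - k) n \<noteq> 0) \<longrightarrow>
       (\<exists>F. F face_of P \<and> aff_dim F = int (DIM('a) - k) \<and> (\<forall>v\<in>lin F. orthogonal l v)))"
proof -
  have P: "polytope P" using assms(2) by (simp add: rational_polytope_def)
  obtain c where c: "\<And>s. s \<ge> 0 \<Longrightarrow> integral ((\<lambda>x. s *\<^sub>R x) ` P) (wave l) = face_sum l P c s"
    using integral_wave_scale[OF P assms(3)] by blast
  define m where "m F = nat (aff_dim F)" for F :: "'a set"
  \<comment> \<open>\<open>A F\<close> collects the constants and the oscillating factor in the term
    of \<open>F\<close>, and will have period \<open>t\<close>; \<open>f i\<close> gathers the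
    coefficients of \<open>n ^ i\<close> after expanding the powers of
    \<open>n + \<epsilon>\<close>.\<close>
  define A where "A F n = wave l a * (c F * wave l ((real n + \<epsilon>) *\<^sub>R apex F))" for F n
  define f where "f i n = (\<Sum>F\<in>level_faces l P.
      A F n * (of_nat (m F choose i) * of_real \<epsilon> ^ (m F - i)))" for i n
  have "Phi l ((\<lambda>x. (real n + \<epsilon>) *\<^sub>R x + a) ` P) = (\<Sum>i=0..DIM('a). f i n * of_nat n ^ i)" for n
  proof -
    let ?s = "real n + \<epsilon>"
    have cmp: "compact ((\<lambda>x. ?s *\<^sub>R x) ` P)" using P compact_scaling polytope_imp_compact by blast
    have img: "(\<lambda>x. ?s *\<^sub>R x + a) ` P = (+) a ` (\<lambda>x. ?s *\<^sub>R x) ` P"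
      by (simp add: image_image add.commute)
    have binom: "complex_of_real ?s ^ m F
        = (\<Sum>i=0..DIM('a). of_nat (m F choose i) * of_real \<epsilon> ^ (m F - i) * of_nat n ^ i)" for F
    proof -
      have "m F \<le> DIM('a)" unfolding m_def using aff_dim_le_DIM[of F] by simp
      have "complex_of_real ?s ^ m F = (of_nat n + of_real \<epsilon>) ^ m F" by simp
      also have "\<dots> = (\<Sum>i\<le>m F. of_nat (m F choose i) * of_nat n ^ i * of_real \<epsilon> ^ (m F - i))"
        by (rule binomial_ring)
      \<comment> \<open>Padding up to \<open>DIM('a)\<close> adds only terms with binomial
        coefficient 0, which also makes the truncated exponent \<open>m F - i\<close> harmless
        there.\<close>
      also have "\<dots> = (\<Sum>i=0..DIM('a). of_nat (m F choose i) * of_nat n ^ i * of_real \<epsilon> ^ (m F - i))"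
        using \<open>m F \<le> DIM('a)\<close> by (intro sum.mono_neutral_left) auto
      finally show ?thesis by (simp add: ac_simps)
    qed
    have "Phi l ((\<lambda>x. ?s *\<^sub>R x + a) ` P) = wave l a * face_sum l P c ?s"
      unfolding img using assms(7)
      by (simp add: Phi_eq_integral compact_translation cmp integral_wave_translate c)
    also have "\<dots> = (\<Sum>F\<in>level_faces l P. A F n * complex_of_real ?s ^ m F)"
      unfolding face_sum_def sum_distrib_left A_def m_def by (intro sum.cong refl) (simp add: ac_simps)
    also have "\<dots> = (\<Sum>F\<in>level_faces l P. \<Sum>i=0..DIM('a).
        A F n * (of_nat (m F choose i) * of_real \<epsilon> ^ (m F - i)) * of_nat n ^ i)"
      unfolding binom sum_distrib_left by (simp add: mult.assoc)
    also have "\<dots> = (\<Sum>i=0..DIM('a). f i n * of_nat n ^ i)"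
      unfolding f_def sum_distrib_right by (rule sum.swap)
    finally show ?thesis .
  qed
  moreover have "f i (n + t) = f i n" for n i
  proof -
    have "A F (n + t) = A F n" if F: "F \<in> level_faces l P" for F
    proof -
      have FP: "F face_of P" "F \<noteq> {}" using F by (auto simp: level_faces_def)
      \<comment> \<open>Viewing the apex as a singleton face carries it through the scaling:
        \<open>t\<close> times it is a vertex of the scaled polytope, hence a lattice point.\<close>
      have "{apex F} face_of P" using apex_extreme(2)[OF P FP] by (simp add: face_of_singleton)
      then have "(\<lambda>x. real t *\<^sub>R x) ` {apex F} face_of (\<lambda>x. real t *\<^sub>R x) ` P"
        using assms(4) by (subst face_of_linear_image) (auto simp: inj_on_def)
      then have "real t *\<^sub>R apex F \<in> \<Lambda>"
        using assms(5) by (auto simp: face_of_singleton lattice_polytope_def)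
      then have "wave l (real t *\<^sub>R apex F) = 1"
        using assms(8) unfolding dual_lattice_def by (intro wave_Ints) blast
      moreover have "(real (n + t) + \<epsilon>) *\<^sub>R apex F = (real n + \<epsilon>) *\<^sub>R apex F + real t *\<^sub>R apex F"
        by (simp add: algebra_simps)
      ultimately show ?thesis by (simp add: A_def wave_add)
    qed
    then show ?thesis unfolding f_def by (intro sum.cong) auto
  qed
  moreover have "\<exists>F. F face_of P \<and> aff_dim F = int i \<and> (\<forall>v\<in>lin F. orthogonal l v)"
    if nz: "f i n \<noteq> 0" for i n
  proof -
    \<comment> \<open>A nonzero coefficient needs a level face of dimension at least
      \<open>i\<close>, since \<open>m F choose i\<close> vanishes for smaller faces.\<close>
    from nz obtain F where F: "F \<in> level_faces l P" and "m F choose i \<noteq> 0"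
      unfolding f_def by (metis (no_types, lifting) sum.neutral mult_zero_left mult_zero_right of_nat_0)
    then have "i \<le> m F" by (meson binomial_eq_0 not_le)
    have FP: "F face_of P" "F \<noteq> {}" and orth: "\<forall>v\<in>lin F. orthogonal l v"
      using F by (auto simp: level_faces_def)
    have "aff_dim F \<ge> 0" using dim_lin[OF FP(2)] by (metis of_nat_0_le_iff)
    then have "int i \<le> aff_dim F" using \<open>i \<le> m F\<close> by (simp add: m_def)
    \<comment> \<open>A subface has a smaller direction space and so inherits orthogonality to
      \<open>l\<close>.\<close>
    then obtain F' where F': "F' face_of F" "aff_dim F' = int i"
      using polytope_subface_exists[OF face_of_polytope_polytope[OF P FP(1)] FP(2)] by blast
    have "F' face_of P" using F'(1) FP(1) face_of_trans by blast
    moreover have "\<forall>v\<in>lin F'. orthogonal l v" using orth lin_mono[OF face_of_imp_subset[OF F'(1)]] by blast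
    ultimately show ?thesis using F'(2) by blast
  qed
  ultimately show ?thesis by blast
qed

end
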